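(* Let $G\le\operatorname{Aut}(T_X)$ be a perfect, self-similar subgroup that satisfies property H. Then for every non-empty subset $\Omega\subseteq\mathcal{S}$ the group $\Gamma_G^{\Omega}$ is just infinite and satisfies the congruence subgroup property.
   Context: Let $X$ be a non-empty finite set with a fixed element $o\in X$ and $X^+=X\setminus\{o\}$. $X^*$ is the set of finite words over $X$; $T_X$ is the rooted tree with vertex set $X^*$, root the empty word, and edges joining $w$ to $wx$ ($w\in X^*$, $x\in X$); level $\ell$ is $X^\ell$. $\operatorname{Aut}(T_X)$ is the group of root-fixing graph automorphisms. For $\alpha\in\operatorname{Aut}(T_X)$, $\sigma_\alpha\in\operatorname{Sym}(X)$ is the induced permutation of level 1, and for $x\in X$ the state $\alpha_x\in\operatorname{Aut}(T_X)$ is defined by $\alpha(xw)=\sigma_\alpha(x)\alpha_x(w)$ for all $w\in X^*$. A subgroup $G\le\operatorname{Aut}(T_X)$ is self-similar if $g_x\in G$ for all $g\in G,x\in X$. It has property H if it acts transitively on $X$ and for all $x\ne y$ in $X$ there is $g\in G$ with $g(x)=x$ and $g(y)\ne y$. $\mathcal{S}$ is the set of infinite sequences $\omega=(\omega_k)_{k\ge1}$ over $X^+$; $L(\omega_1,\omega_2,\dots)=(\omega_2,\omega_3,\dots)$. For $\alpha\in\operatorname{Aut}(T_X)$ and $\omega\in\mathcal{S}$, $\widetilde{\alpha}^{\omega}\in\operatorname{Aut}(T_X)$ fixes level 1 pointwise and is given recursively by its states: $\widetilde{\alpha}^{L(\omega)}$ at $o$, $\alpha$ at $\omega_1$, and $\operatorname{id}$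 at every other $x\in X$. $\Gamma_G^{\Omega}$ is the subgroup of $\operatorname{Aut}(T_X)$ generated by $G$ and all $\widetilde{g}^{\omega}$ with $g\in G,\omega\in\Omega$. An infinite group is just infinite if each of its proper quotients is finite. $\operatorname{Aut}(T_X)$ is a profinite group with the pointwise stabilizers of the levels $X^\ell$ as a base of neighbourhoods of the identity. For $\Gamma\le\operatorname{Aut}(T_X)$, $\overline{\Gamma}$ is its closure and $\widehat{\Gamma}=\varprojlim_N\Gamma/N$ ($N$ ranging over finite index normal subgroups) its profinite completion. $\Gamma$ satisfies the congruence subgroup property if the canonical homomorphism $\widehat{\Gamma}\to\overline{\Gamma}$ extending the inclusion $\Gamma\to\overline{\Gamma}$ is an isomorphism; equivalently, every finite index normal subgroup of $\Gamma$ contains the pointwise stabilizer in $\Gamma$ of some level $X^\ell$. *)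

theory Defs
  imports
    "HOL-Algebra.Generated_Groups"
    "HOL-Algebra.Product_Groups"
    "HOL-Analysis.Function_Topology"
begin

section \<open>The rooted tree and its automorphism group\<close>

text \<open>
  The finite non-empty set \<open>X\<close> is a type of class \<open>finite\<close>; the vertices of the
  tree are the lists over that type.
\<close>

definition tree_edge :: "'x list \<Rightarrow> 'x list \<Rightarrow> bool" where
  "tree_edge u v \<longleftrightarrow> (\<exists>x. v = u @ [x]) \<or> (\<exists>x. u = v @ [x])"

definition tree_auts :: "('x list \<Rightarrow> 'x list) set" where
  "tree_auts = {\<alpha>. bij \<alpha> \<and> \<alpha> [] = [] \<and> (\<forall>u v. tree_edge (\<alpha> u) (\<alpha> v) \<longleftrightarrow> tree_edge u v)}"

definition aut_tree :: "('x list \<Rightarrow> 'x list) monoid" where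
  "aut_tree = \<lparr>carrier = tree_auts, mult = (\<circ>), one = id\<rparr>"

definition level_perm :: "('x list \<Rightarrow> 'x list) \<Rightarrow> 'x \<Rightarrow> 'x" where
  "level_perm \<alpha> x = hd (\<alpha> [x])"

text \<open>
  Together with \<^term>\<open>level_perm\<close>, the state is characterised by the equation in lemma
  \<open>tree_aut_Cons\<close> below.
\<close>

definition state :: "('x list \<Rightarrow> 'x list) \<Rightarrow> 'x \<Rightarrow> 'x list \<Rightarrow> 'x list" where
  "state \<alpha> x w = tl (\<alpha> (x # w))"

definition level_stab :: "nat \<Rightarrow> ('x list \<Rightarrow> 'x list) set" where
  "level_stab l = {\<alpha> \<in> tree_auts. \<forall>w. length w = l \<longrightarrow> \<alpha> w = w}"

definition self_similar :: "('x list \<Rightarrow> 'x list) set \<Rightarrow> bool" where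
  "self_similar G \<longleftrightarrow> (\<forall>g\<in>G. \<forall>x. state g x \<in> G)"

definition property_H :: "('x list \<Rightarrow> 'x list) set \<Rightarrow> bool" where
  "property_H G \<longleftrightarrow>
     (\<forall>x y. \<exists>g\<in>G. level_perm g x = y) \<and>
     (\<forall>x y. x \<noteq> y \<longrightarrow> (\<exists>g\<in>G. level_perm g x = x \<and> level_perm g y \<noteq> y))"


section \<open>The groups generated by \<open>G\<close> and the directed automorphisms\<close>

text \<open>Sequences are indexed from \<open>0\<close>, so that \<open>\<omega> 0\<close> is the first letter.\<close>

definition spine_seqs :: "'x \<Rightarrow> (nat \<Rightarrow> 'x) set" where
  "spine_seqs b = {\<omega>. \<forall>k. \<omega> k \<noteq> b}"

definition seq_shift :: "(nat \<Rightarrow> 'x) \<Rightarrow> nat \<Rightarrow> 'x" where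
  "seq_shift \<omega> = (\<lambda>k. \<omega> (Suc k))"

fun directed :: "'x \<Rightarrow> ('x list \<Rightarrow> 'x list) \<Rightarrow> (nat \<Rightarrow> 'x) \<Rightarrow> 'x list \<Rightarrow> 'x list" where
  "directed b \<alpha> \<omega> [] = []"
| "directed b \<alpha> \<omega> (x # w) =
     x # (if x = b then directed b \<alpha> (seq_shift \<omega>) w else if x = \<omega> 0 then \<alpha> w else w)"

definition Gam :: "'x \<Rightarrow> ('x list \<Rightarrow> 'x list) set \<Rightarrow> (nat \<Rightarrow> 'x) set \<Rightarrow> ('x list \<Rightarrow> 'x list) set" where
  "Gam b G \<Omega> = generate aut_tree (G \<union> {directed b g \<omega> | g \<omega>. g \<in> G \<and> \<omega> \<in> \<Omega>})"


section \<open>Perfect and just infinite groups, profinite completion\<close>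

definition perfect_group :: "('a, 'b) monoid_scheme \<Rightarrow> bool" where
  "perfect_group \<Gamma> \<longleftrightarrow> group \<Gamma> \<and> derived \<Gamma> (carrier \<Gamma>) = carrier \<Gamma>"

definition just_infinite :: "('a, 'b) monoid_scheme \<Rightarrow> bool" where
  "just_infinite \<Gamma> \<longleftrightarrow> group \<Gamma> \<and> infinite (carrier \<Gamma>) \<and>
     (\<forall>N. N \<lhd> \<Gamma> \<and> N \<noteq> {\<one>\<^bsub>\<Gamma>\<^esub>} \<longrightarrow> finite (carrier (\<Gamma> Mod N)))"

definition fin_index_normals :: "('a, 'b) monoid_scheme \<Rightarrow> 'a set set" where
  "fin_index_normals \<Gamma> = {N. N \<lhd> \<Gamma> \<and> finite (carrier (\<Gamma> Mod N))}"

text \<open>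
  For \<open>M \<subseteq> N\<close> the transition map sends a coset of \<open>M\<close> to the unique coset of \<open>N\<close>
  containing it; hence a family of cosets is compatible iff \<open>c M \<subseteq> c N\<close> whenever \<open>M \<subseteq> N\<close>.
\<close>

definition profinite_completion :: "('a, 'b) monoid_scheme \<Rightarrow> ('a set \<Rightarrow> 'a set) monoid" where
  "profinite_completion \<Gamma> =
     (product_group (fin_index_normals \<Gamma>) (\<lambda>N. \<Gamma> Mod N))
       \<lparr>carrier := {c \<in> (\<Pi>\<^sub>E N\<in>fin_index_normals \<Gamma>. carrier (\<Gamma> Mod N)).
          \<forall>M\<in>fin_index_normals \<Gamma>. \<forall>N\<in>fin_index_normals \<Gamma>. M \<subseteq> N \<longrightarrow> c M \<subseteq> c N}\<rparr>"

definition profinite_topology :: "('a, 'b) monoid_scheme \<Rightarrow> ('a set \<Rightarrow> 'a set) topology" where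
  "profinite_topology \<Gamma> =
     subtopology
       (product_topology (\<lambda>N. discrete_topology (carrier (\<Gamma> Mod N))) (fin_index_normals \<Gamma>))
       (carrier (profinite_completion \<Gamma>))"

definition to_completion :: "('a, 'b) monoid_scheme \<Rightarrow> 'a \<Rightarrow> 'a set \<Rightarrow> 'a set" where
  "to_completion \<Gamma> \<gamma> = (\<lambda>N\<in>fin_index_normals \<Gamma>. N #>\<^bsub>\<Gamma>\<^esub> \<gamma>)"


section \<open>The congruence subgroup property\<close>

definition aut_topology :: "('x list \<Rightarrow> 'x list) topology" where
  "aut_topology =
     topology (\<lambda>U. U \<subseteq> tree_auts \<and> (\<forall>\<alpha>\<in>U. \<exists>l. \<alpha> <#\<^bsub>aut_tree\<^esub> level_stab l \<subseteq> U))"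

definition tree_closure :: "('x list \<Rightarrow> 'x list) set \<Rightarrow> ('x list \<Rightarrow> 'x list) set" where
  "tree_closure \<Gamma> = aut_topology closure_of \<Gamma>"

text \<open>
  The image of \<open>\<Gamma>\<close> is dense in its profinite completion and \<^term>\<open>aut_topology\<close> is
  Hausdorff, so there is at most one continuous map \<open>\<phi>\<close> compatible with the inclusion of
  \<open>\<Gamma>\<close>, namely the canonical homomorphism. The condition therefore says that the
  canonical homomorphism is an isomorphism of topological groups.
\<close>

definition congruence_subgroup_property :: "('x list \<Rightarrow> 'x list) set \<Rightarrow> bool" where
  "congruence_subgroup_property \<Gamma> \<longleftrightarrow>
     (let \<Gamma>' = aut_tree\<lparr>carrier := \<Gamma>\<rparr> in
      \<exists>\<phi>. (\<forall>\<gamma>\<in>\<Gamma>. \<phi> (to_completion \<Gamma>' \<gamma>) = \<gamma>) \<and>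
          \<phi> \<in> iso (profinite_completion \<Gamma>') (aut_tree\<lparr>carrier := tree_closure \<Gamma>\<rparr>) \<and>
          homeomorphic_map (profinite_topology \<Gamma>') (subtopology aut_topology (tree_closure \<Gamma>)) \<phi>)"


section \<open>Well-definedness\<close>

lemma tree_auts_snoc:
  assumes "\<alpha> \<in> tree_auts"
  shows "\<exists>y. \<alpha> (w @ [x]) = \<alpha> w @ [y]"
proof (induction w arbitrary: x rule: rev_induct)
  case Nil
  have "tree_edge [] [x]" by (simp add: tree_edge_def)
  then have "tree_edge (\<alpha> []) (\<alpha> [x])" "\<alpha> [] = []"
    using assms unfolding tree_auts_def by blast+
  then show ?case by (auto simp: tree_edge_def)
next
  case (snoc z w)
  have "tree_edge (w @ [z]) ((w @ [z]) @ [x])" unfolding tree_edge_def by blast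
  then have e: "tree_edge (\<alpha> (w @ [z])) (\<alpha> ((w @ [z]) @ [x]))"
    using assms by (simp add: tree_auts_def)
  obtain y where y: "\<alpha> (w @ [z]) = \<alpha> w @ [y]" using snoc by blast
  have "inj \<alpha>" using assms by (simp add: tree_auts_def bij_def)
  then have "\<alpha> w \<noteq> \<alpha> ((w @ [z]) @ [x])" by (auto dest: injD)
  then show ?case using e y by (auto simp: tree_edge_def)
qed

lemma tree_auts_append:
  assumes "\<alpha> \<in> tree_auts"
  shows "\<exists>v'. length v' = length v \<and> \<alpha> (u @ v) = \<alpha> u @ v'"
proof (induction v rule: rev_induct)
  case (snoc x v)
  then obtain v' where "length v' = length v" "\<alpha> (u @ v) = \<alpha> u @ v'" by blast
  moreover obtain y where "\<alpha> ((u @ v) @ [x]) = \<alpha> (u @ v) @ [y]"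
    using tree_auts_snoc[OF assms] by blast
  ultimately show ?case by (intro exI[of _ "v' @ [y]"]) auto
qed auto

lemma length_tree_aut:
  assumes "\<alpha> \<in> tree_auts"
  shows "length (\<alpha> w) = length w"
  using tree_auts_append[OF assms, of w "[]"] assms by (auto simp: tree_auts_def)

lemma tree_aut_Cons:
  assumes "\<alpha> \<in> tree_auts"
  shows "\<alpha> (x # w) = level_perm \<alpha> x # state \<alpha> x w"
proof -
  obtain v' where v: "\<alpha> ([x] @ w) = \<alpha> [x] @ v'"
    using tree_auts_append[OF assms, of w "[x]"] by blast
  have "length (\<alpha> [x]) = 1" using length_tree_aut[OF assms, of "[x]"] by simp
  then obtain y where "\<alpha> [x] = [y]" by (auto simp: length_Suc_conv)
  then show ?thesis using v by (simp add: level_perm_def state_def)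
qed

lemma tree_auts_comp:
  assumes "\<alpha> \<in> tree_auts" "\<beta> \<in> tree_auts"
  shows "\<alpha> \<circ> \<beta> \<in> tree_auts"
  using assms by (auto simp: tree_auts_def intro: bij_comp)

lemma tree_auts_inv:
  assumes "\<alpha> \<in> tree_auts"
  shows "inv_into UNIV \<alpha> \<in> tree_auts"
proof -
  have b: "bij \<alpha>" and r: "\<alpha> [] = []" and e: "\<And>u v. tree_edge (\<alpha> u) (\<alpha> v) \<longleftrightarrow> tree_edge u v"
    using assms by (auto simp: tree_auts_def)
  have "inv_into UNIV \<alpha> [] = []" using b r by (metis bij_inv_eq_iff)
  moreover have "tree_edge (inv_into UNIV \<alpha> u) (inv_into UNIV \<alpha> v) \<longleftrightarrow> tree_edge u v" for u v
    using e[of "inv_into UNIV \<alpha> u" "inv_into UNIV \<alpha> v"] b by (simp add: bij_is_surj surj_f_inv_f)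
  ultimately show ?thesis using b by (simp add: tree_auts_def bij_imp_bij_inv)
qed

lemma group_aut_tree: "group aut_tree"
proof (rule groupI)
  fix \<alpha> :: "'x list \<Rightarrow> 'x list"
  assume a: "\<alpha> \<in> carrier aut_tree"
  then have "inj \<alpha>" by (simp add: aut_tree_def tree_auts_def bij_def)
  then have "inv_into UNIV \<alpha> \<otimes>\<^bsub>aut_tree\<^esub> \<alpha> = \<one>\<^bsub>aut_tree\<^esub>" by (simp add: aut_tree_def)
  moreover have "inv_into UNIV \<alpha> \<in> carrier aut_tree" using a by (simp add: aut_tree_def tree_auts_inv)
  ultimately show "\<exists>\<beta>\<in>carrier aut_tree. \<beta> \<otimes>\<^bsub>aut_tree\<^esub> \<alpha> = \<one>\<^bsub>aut_tree\<^esub>" by blast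
qed (auto simp: aut_tree_def tree_auts_comp, simp add: tree_auts_def)

lemma tree_edge_Cons [simp]: "tree_edge (x # u) (y # v) \<longleftrightarrow> x = y \<and> tree_edge u v"
  by (auto simp: tree_edge_def)

lemma tree_edge_Nil:
  "tree_edge [] v \<longleftrightarrow> length v = 1" "tree_edge v [] \<longleftrightarrow> length v = 1"
  by (auto simp: tree_edge_def length_Suc_conv)

lemma state_tree_aut:
  assumes "\<alpha> \<in> tree_auts"
  shows "state \<alpha> x \<in> tree_auts"
proof -
  have b: "bij \<alpha>" and e: "\<And>u v. tree_edge (\<alpha> u) (\<alpha> v) \<longleftrightarrow> tree_edge u v"
    using assms by (auto simp: tree_auts_def)
  note c = tree_aut_Cons[OF assms]
  have "tree_edge (state \<alpha> x u) (state \<alpha> x v) \<longleftrightarrow> tree_edge u v" for u v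
    using e[of "x # u" "x # v"] by (simp add: c)
  moreover have "state \<alpha> x [] = []"
    using length_tree_aut[OF assms, of "[x]"] c[of x "[]"] by simp
  moreover have "inj (state \<alpha> x)"
  proof (rule injI)
    fix u v assume "state \<alpha> x u = state \<alpha> x v"
    then have "\<alpha> (x # u) = \<alpha> (x # v)" by (simp add: c)
    then show "u = v" using b by (simp add: bij_def inj_eq)
  qed
  moreover have "surj (state \<alpha> x)"
  proof (rule surjI)
    fix v
    let ?p = "inv_into UNIV \<alpha>"
    have p: "?p \<in> tree_auts" by (rule tree_auts_inv[OF assms])
    have "?p (\<alpha> [x]) = [x]" using b by (simp add: bij_is_inj)
    moreover have "\<alpha> [x] = [level_perm \<alpha> x]"
      using c[of x "[]"] length_tree_aut[OF assms, of "[x]"] by simp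
    ultimately have "level_perm ?p (level_perm \<alpha> x) = x"
      by (simp add: level_perm_def[of ?p])
    then have "?p (level_perm \<alpha> x # v) = x # state ?p (level_perm \<alpha> x) v"
      using tree_aut_Cons[OF p] by simp
    then have "\<alpha> (x # state ?p (level_perm \<alpha> x) v) = level_perm \<alpha> x # v"
      using b by (metis bij_inv_eq_iff)
    then show "state \<alpha> x (state ?p (level_perm \<alpha> x) v) = v" by (simp add: c)
  qed
  ultimately show ?thesis by (simp add: tree_auts_def bij_def)
qed

lemma length_directed:
  assumes "\<alpha> \<in> tree_auts"
  shows "length (directed b \<alpha> \<omega> w) = length w"
  by (induction b \<alpha> \<omega> w rule: directed.induct[where P = "\<lambda>b' \<alpha>' \<omega> w. \<alpha>' = \<alpha> \<longrightarrow> length (directed b' \<alpha>' \<omega> w) = length w", THEN mp])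
     (auto simp: length_tree_aut[OF assms])

lemma directed_inverse:
  assumes "\<And>w. \<beta> (\<alpha> w) = w"
  shows "directed b \<beta> \<omega> (directed b \<alpha> \<omega> w) = w"
  using assms by (induction w arbitrary: \<omega>) auto

lemma directed_tree_aut:
  assumes "\<alpha> \<in> tree_auts"
  shows "directed b \<alpha> \<omega> \<in> tree_auts"
proof -
  have b: "bij \<alpha>" and e: "\<And>u v. tree_edge (\<alpha> u) (\<alpha> v) \<longleftrightarrow> tree_edge u v"
    using assms by (auto simp: tree_auts_def)
  have "bij (directed b \<alpha> \<omega>)"
    by (rule o_bij[of "directed b (inv_into UNIV \<alpha>) \<omega>"])
       (use b in \<open>auto simp: fun_eq_iff bij_is_inj bij_is_surj surj_f_inv_f intro!: directed_inverse\<close>)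
  moreover have "tree_edge (directed b \<alpha> \<omega> u) (directed b \<alpha> \<omega> v) \<longleftrightarrow> tree_edge u v" for u v
  proof (induction u arbitrary: \<omega> v)
    case Nil
    then show ?case by (simp add: tree_edge_Nil length_directed[OF assms])
  next
    case (Cons x u)
    show ?case
    proof (cases v)
      case Nil
      then show ?thesis
        by (simp only: directed.simps(1) tree_edge_Nil length_directed[OF assms])
    next
      case (Cons y v')
      then show ?thesis using Cons.IH e by auto
    qed
  qed
  ultimately show ?thesis by (simp add: tree_auts_def)
qed

lemma openin_aut_topology:
  fixes U :: "('x list \<Rightarrow> 'x list) set"
  shows "openin aut_topology U \<longleftrightarrow>
     U \<subseteq> tree_auts \<and> (\<forall>\<alpha>\<in>U. \<exists>l. \<alpha> <#\<^bsub>aut_tree\<^esub> level_stab l \<subseteq> U)"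
proof -
  have mono: "level_stab m \<subseteq> (level_stab l :: ('x list \<Rightarrow> 'x list) set)" if "l \<le> m" for l m
  proof
    fix \<alpha> :: "'x list \<Rightarrow> 'x list"
    assume a: "\<alpha> \<in> level_stab m"
    then have A: "\<alpha> \<in> tree_auts" by (simp add: level_stab_def)
    have "\<alpha> w = w" if "length w = l" for w
    proof -
      define v where "v = replicate (m - l) (undefined :: 'x)"
      have "\<alpha> (w @ v) = w @ v"
        using a that \<open>l \<le> m\<close> by (simp add: level_stab_def v_def)
      moreover obtain v' where "\<alpha> (w @ v) = \<alpha> w @ v'"
        using tree_auts_append[OF A] by blast
      ultimately show ?thesis using length_tree_aut[OF A, of w] by simp
    qed
    then show "\<alpha> \<in> level_stab l" using A by (simp add: level_stab_def)
  qed
  have "istopology (\<lambda>U. U \<subseteq> tree_auts \<and>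
      (\<forall>\<alpha>\<in>U. \<exists>l. \<alpha> <#\<^bsub>aut_tree\<^esub> level_stab l \<subseteq> (U :: ('x list \<Rightarrow> 'x list) set)))"
    unfolding istopology_def
  proof (intro conjI allI impI ballI; (elim conjE)?)
    fix S T :: "('x list \<Rightarrow> 'x list) set" and \<alpha>
    assume S: "\<forall>\<alpha>\<in>S. \<exists>l. \<alpha> <#\<^bsub>aut_tree\<^esub> level_stab l \<subseteq> S"
      and T: "\<forall>\<alpha>\<in>T. \<exists>l. \<alpha> <#\<^bsub>aut_tree\<^esub> level_stab l \<subseteq> T" and a: "\<alpha> \<in> S \<inter> T"
    obtain l m where "\<alpha> <#\<^bsub>aut_tree\<^esub> level_stab l \<subseteq> S" "\<alpha> <#\<^bsub>aut_tree\<^esub> level_stab m \<subseteq> T"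
      using S T a by blast
    then have "\<alpha> <#\<^bsub>aut_tree\<^esub> level_stab (max l m) \<subseteq> S \<inter> T"
      using mono[of l "max l m"] mono[of m "max l m"] by (fastforce simp: l_coset_def)
    then show "\<exists>l. \<alpha> <#\<^bsub>aut_tree\<^esub> level_stab l \<subseteq> S \<inter> T" by blast
  next
    fix \<K> :: "('x list \<Rightarrow> 'x list) set set" and \<alpha>
    assume K: "\<forall>K\<in>\<K>. K \<subseteq> tree_auts \<and> (\<forall>\<alpha>\<in>K. \<exists>l. \<alpha> <#\<^bsub>aut_tree\<^esub> level_stab l \<subseteq> K)"
      and "\<alpha> \<in> \<Union>\<K>"
    then obtain K l where "K \<in> \<K>" "\<alpha> <#\<^bsub>aut_tree\<^esub> level_stab l \<subseteq> K" by blast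
    then show "\<exists>l. \<alpha> <#\<^bsub>aut_tree\<^esub> level_stab l \<subseteq> \<Union>\<K>" by blast
  qed blast+
  then show ?thesis unfolding aut_topology_def by (subst topology_inverse') auto
qed

end

theory Submission
  imports Defs
begin

text \<open>
  Write \<open>\<Gamma>(\<Omega>)\<close> for the group \<open>Gam b G \<Omega>\<close> and \<open>L\<Omega>\<close> for the set of shifts of the
  sequences in \<open>\<Omega>\<close>. The proof rests on the fact that \<open>\<Gamma>(\<Omega>)\<close> is as branched as it can be:
  for every vertex \<open>v\<close> of level \<open>n\<close> and every \<open>\<beta> \<in> \<Gamma>(L\<^sup>n\<Omega>)\<close>, the automorphism that acts as
  \<open>\<beta>\<close> below \<open>v\<close> and trivially elsewhere (the graft of \<open>\<beta>\<close> at \<open>v\<close>) lies in \<open>\<Gamma>(\<Omega>)\<close>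
  (\<open>graft_in_Gam\<close>), whereas all states of elements of \<open>\<Gamma>(\<Omega>)\<close> at level \<open>n\<close> lie in
  \<open>\<Gamma>(L\<^sup>n\<Omega>)\<close>. So the stabilizer of level \<open>n\<close> in \<open>\<Gamma>(\<Omega>)\<close> is the direct product of copies of
  \<open>\<Gamma>(L\<^sup>n\<Omega>)\<close>, one for each vertex of that level.

  The grafts come from a commutator trick. The directed automorphism of \<open>g\<close> along \<open>\<omega>\<close> is
  supported below \<open>b\<close> and \<open>c = \<omega> 0\<close>. Property H gives \<open>k \<in> G\<close> fixing \<open>c\<close> and
  moving \<open>b\<close>; conjugation by \<open>k\<close> yields an element that is supported below \<open>c\<close> and another
  letter, so that its commutator with the directed automorphism of \<open>h\<close> survives below \<open>c\<close>
  only, where it is a commutator of elements of \<open>G\<close>. As \<open>G\<close> is perfect, all of \<open>G\<close> can be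
  grafted at \<open>c\<close>. Dividing by this graft isolates the part below \<open>b\<close> of a directed
  automorphism, and transitivity carries grafts to all the other letters.

  \<open>\<Gamma>(\<Omega>)\<close> is itself perfect and transitive on every level. If a normal subgroup \<open>N\<close> contains
  an element moving a vertex \<open>u\<close> of level \<open>n\<close>, then the double commutators of this element
  with grafts at \<open>u\<close> show that \<open>N\<close> contains all grafts at \<open>u\<close> of commutators, hence of all
  elements, of \<open>\<Gamma>(L\<^sup>n\<Omega>)\<close>. By transitivity \<open>N\<close> contains the whole stabilizer of level
  \<open>n\<close> (\<open>normal_contains_level_stab\<close>).

  Level stabilizers have finite index, so \<open>\<Gamma>(\<Omega>)\<close> is just infinite. Since it is infinite,
  its finite index normal subgroups are non-trivial; hence the level stabilizers are cofinal
  among them. A compatible family of cosets is then determined by its values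
  on the level stabilizers, that is, by an automorphism of the tree in the closure of
  \<open>\<Gamma>(\<Omega>)\<close>, and this correspondence is the required isomorphism.
\<close>

section \<open>Subgroups of the automorphism group of the tree\<close>

abbreviation aut_inv :: "('x list \<Rightarrow> 'x list) \<Rightarrow> 'x list \<Rightarrow> 'x list" where
  "aut_inv \<alpha> \<equiv> inv_into UNIV \<alpha>"

lemma aut_inv_simps [simp]:
  assumes "\<alpha> \<in> tree_auts"
  shows "\<alpha> (aut_inv \<alpha> w) = w" "aut_inv \<alpha> (\<alpha> w) = w"
  using assms by (auto simp: tree_auts_def bij_is_surj bij_is_inj surj_f_inv_f)

lemma aut_inv_comp [simp]:
  assumes "\<alpha> \<in> tree_auts"
  shows "\<alpha> \<circ> aut_inv \<alpha> = id" "aut_inv \<alpha> \<circ> \<alpha> = id"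
  using assms by (auto simp: fun_eq_iff)

lemma id_tree_aut [simp]: "id \<in> tree_auts"
  by (simp add: tree_auts_def)

lemma aut_tree_simps [simp]:
  "carrier aut_tree = tree_auts" "\<one>\<^bsub>aut_tree\<^esub> = id" "\<alpha> \<otimes>\<^bsub>aut_tree\<^esub> \<beta> = \<alpha> \<circ> \<beta>"
  by (simp_all add: aut_tree_def)

lemma inv_aut_tree [simp]:
  assumes "\<alpha> \<in> tree_auts"
  shows "inv\<^bsub>aut_tree\<^esub> \<alpha> = aut_inv \<alpha>"
  by (rule group.inv_equality[OF group_aut_tree]) (use assms in \<open>auto simp: tree_auts_inv\<close>)

lemma subgroup_aut_treeD:
  assumes "subgroup H aut_tree"
  shows "\<alpha> \<in> H \<Longrightarrow> \<alpha> \<in> tree_auts" "id \<in> H"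
    "\<alpha> \<in> H \<Longrightarrow> \<beta> \<in> H \<Longrightarrow> \<alpha> \<circ> \<beta> \<in> H" "\<alpha> \<in> H \<Longrightarrow> aut_inv \<alpha> \<in> H"
proof -
  show t: "\<alpha> \<in> H \<Longrightarrow> \<alpha> \<in> tree_auts" for \<alpha> using subgroup.subset[OF assms] by auto
  show "id \<in> H" using subgroup.one_closed[OF assms] by simp
  show "\<alpha> \<in> H \<Longrightarrow> \<beta> \<in> H \<Longrightarrow> \<alpha> \<circ> \<beta> \<in> H" using subgroup.m_closed[OF assms] by simp
  show "\<alpha> \<in> H \<Longrightarrow> aut_inv \<alpha> \<in> H" using subgroup.m_inv_closed[OF assms] t by fastforce
qed

lemma subgroup_aut_treeI:
  assumes "H \<subseteq> tree_auts" "id \<in> H" "\<And>\<alpha> \<beta>. \<alpha> \<in> H \<Longrightarrow> \<beta> \<in> H \<Longrightarrow> \<alpha> \<circ> \<beta> \<in> H"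
    "\<And>\<alpha>. \<alpha> \<in> H \<Longrightarrow> aut_inv \<alpha> \<in> H"
  shows "subgroup H aut_tree"
proof (rule group.subgroupI[OF group_aut_tree])
  fix \<alpha> assume "\<alpha> \<in> H" then show "inv\<^bsub>aut_tree\<^esub> \<alpha> \<in> H" using assms(1,4) by (simp add: subset_iff)
qed (use assms in auto)

text \<open>
  Throughout, \<open>\<gamma>\<close> is recognised as the commutator of \<open>\<alpha>\<close> and \<open>\<beta>\<close> by the equation
  \<open>\<alpha> \<circ> \<beta> = \<gamma> \<circ> (\<beta> \<circ> \<alpha>)\<close>: it is free of inverses, so that it can be checked vertex by vertex and is
  visibly preserved by the multiplicative maps \<open>graft v\<close> and \<open>\<lambda>\<alpha>. directed b \<alpha> \<omega>\<close>.
\<close>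
lemma commutator_in_subgroup:
  assumes H: "subgroup H aut_tree" and "\<alpha> \<in> H" "\<beta> \<in> H" "\<alpha> \<circ> \<beta> = \<gamma> \<circ> (\<beta> \<circ> \<alpha>)"
  shows "\<gamma> \<in> H"
proof -
  have "\<gamma> = (\<alpha> \<circ> \<beta>) \<circ> (aut_inv \<alpha> \<circ> aut_inv \<beta>)"
    using subgroup_aut_treeD(1)[OF H] assms(2-3) by (auto simp: assms(4) fun_eq_iff)
  then show ?thesis using assms(2,3) subgroup_aut_treeD[OF H] by metis
qed

lemma derived_leI:
  assumes K: "K \<subseteq> tree_auts" and H: "subgroup H aut_tree"
    and "\<And>\<alpha> \<beta> \<gamma>. \<lbrakk>\<alpha> \<in> K; \<beta> \<in> K; \<gamma> \<in> tree_auts; \<alpha> \<circ> \<beta> = \<gamma> \<circ> (\<beta> \<circ> \<alpha>)\<rbrakk> \<Longrightarrow> \<gamma> \<in> H"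
  shows "derived aut_tree K \<subseteq> H"
  unfolding derived_def
proof (rule group.generate_subgroup_incl[OF group_aut_tree _ H], safe)
  fix \<alpha> \<beta> assume ab: "\<alpha> \<in> K" "\<beta> \<in> K"
  then have t: "\<alpha> \<in> tree_auts" "\<beta> \<in> tree_auts" using K by auto
  have "\<alpha> \<circ> \<beta> \<circ> aut_inv \<alpha> \<circ> aut_inv \<beta> \<in> H"
    by (rule assms(3)[OF ab]) (use t in \<open>auto simp: fun_eq_iff tree_auts_comp tree_auts_inv\<close>)
  then show "\<alpha> \<otimes>\<^bsub>aut_tree\<^esub> \<beta> \<otimes>\<^bsub>aut_tree\<^esub> inv\<^bsub>aut_tree\<^esub> \<alpha> \<otimes>\<^bsub>aut_tree\<^esub> inv\<^bsub>aut_tree\<^esub> \<beta> \<in> H"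
    using t by simp
qed

section \<open>Automorphisms supported below one vertex\<close>

definition graft :: "'x list \<Rightarrow> ('x list \<Rightarrow> 'x list) \<Rightarrow> 'x list \<Rightarrow> 'x list" where
  "graft v \<beta> w = (if take (length v) w = v then v @ \<beta> (drop (length v) w) else w)"

lemma graft_append [simp]: "graft v \<beta> (v @ w) = v @ \<beta> w"
  by (simp add: graft_def)

lemma graft_outside: "(\<And>s. w \<noteq> v @ s) \<Longrightarrow> graft v \<beta> w = w"
  unfolding graft_def by (metis append_take_drop_id)

lemma graft_Nil [simp]: "graft [] \<beta> = \<beta>"
  by (auto simp: graft_def)

lemma graft_letter [simp]:
  "graft [x] \<beta> [] = []" "graft [x] \<beta> (y # w) = y # (if y = x then \<beta> w else w)"
  by (auto simp: graft_def)

lemma graft_Cons: "graft (x # v) \<beta> = graft [x] (graft v \<beta>)"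
proof
  fix w show "graft (x # v) \<beta> w = graft [x] (graft v \<beta>) w"
    by (cases w) (auto simp: graft_def)
qed

lemma graft_comp: "graft v (\<alpha> \<circ> \<beta>) = graft v \<alpha> \<circ> graft v \<beta>"
  by (auto simp: graft_def fun_eq_iff)

lemma graft_id [simp]: "graft v id = id"
  by (auto simp: graft_def fun_eq_iff) (metis append_take_drop_id)

lemma graft_aut_inv:
  assumes "\<beta> \<in> tree_auts"
  shows "graft v (aut_inv \<beta>) = aut_inv (graft v \<beta>)"
  by (rule inv_unique_comp[symmetric]) (use assms in \<open>simp_all flip: graft_comp\<close>)

lemma subgroup_graft:
  assumes H: "subgroup H aut_tree"
  shows "subgroup {\<beta> \<in> tree_auts. graft v \<beta> \<in> H} aut_tree"
  by (rule subgroup_aut_treeI)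
    (use subgroup_aut_treeD[OF H] in \<open>auto simp: graft_comp graft_aut_inv tree_auts_comp tree_auts_inv\<close>)

lemma graft_conj:
  assumes a: "\<alpha> \<in> tree_auts" and d: "\<delta> \<in> tree_auts" and ad: "\<And>w. \<alpha> (u @ w) = v @ \<delta> w"
  shows "\<alpha> \<circ> graft u \<beta> \<circ> aut_inv \<alpha> = graft v (\<delta> \<circ> \<beta> \<circ> aut_inv \<delta>)"
proof
  fix w
  show "(\<alpha> \<circ> graft u \<beta> \<circ> aut_inv \<alpha>) w = graft v (\<delta> \<circ> \<beta> \<circ> aut_inv \<delta>) w"
  proof (cases "\<exists>s. w = v @ s")
    case True
    then obtain s where w: "w = v @ s" by blast
    then have "w = \<alpha> (u @ aut_inv \<delta> s)" using d by (simp add: ad)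
    then have "aut_inv \<alpha> w = u @ aut_inv \<delta> s" using a by simp
    then show ?thesis using d by (simp add: w ad)
  next
    case False
    have "aut_inv \<alpha> w \<noteq> u @ s" for s
    proof
      assume "aut_inv \<alpha> w = u @ s"
      then have "w = v @ \<delta> s" using a by (metis ad aut_inv_simps(1))
      then show False using False by blast
    qed
    then have "graft u \<beta> (aut_inv \<alpha> w) = aut_inv \<alpha> w" by (intro graft_outside)
    moreover have "graft v (\<delta> \<circ> \<beta> \<circ> aut_inv \<delta>) w = w" using False by (intro graft_outside) blast
    ultimately show ?thesis using a by simp
  qed
qed

text \<open>
  Grafts move from \<open>u\<close> to \<open>v\<close> by conjugation. This twists the grafted element by the state
  \<open>\<delta>\<close>, which is undone by first conjugating with \<open>\<delta>\<close> inside \<open>K\<close>. In the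
  applications \<open>H\<close> is either a group containing \<open>\<gamma>\<close> or one normalized by it.
\<close>
lemma graft_transport:
  assumes \<gamma>: "\<gamma> \<in> tree_auts" and conj: "\<And>\<nu>. \<nu> \<in> H \<Longrightarrow> \<gamma> \<circ> \<nu> \<circ> aut_inv \<gamma> \<in> H"
    and K: "subgroup K aut_tree" and \<delta>: "\<delta> \<in> K" and \<gamma>\<delta>: "\<And>w. \<gamma> (u @ w) = v @ \<delta> w"
    and u: "\<And>\<beta>. \<beta> \<in> K \<Longrightarrow> graft u \<beta> \<in> H" and \<beta>: "\<beta> \<in> K"
  shows "graft v \<beta> \<in> H"
proof -
  have dt: "\<delta> \<in> tree_auts" using subgroup_aut_treeD(1)[OF K \<delta>] .
  define \<beta>' where "\<beta>' = aut_inv \<delta> \<circ> \<beta> \<circ> \<delta>"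
  have \<beta>': "\<beta>' \<in> K" using \<delta> \<beta> subgroup_aut_treeD[OF K] by (simp add: \<beta>'_def)
  have "\<gamma> \<circ> graft u \<beta>' \<circ> aut_inv \<gamma> = graft v (\<delta> \<circ> \<beta>' \<circ> aut_inv \<delta>)"
    by (rule graft_conj[OF \<gamma> dt \<gamma>\<delta>])
  also have "\<delta> \<circ> \<beta>' \<circ> aut_inv \<delta> = \<beta>" using dt by (simp add: \<beta>'_def fun_eq_iff)
  finally show ?thesis using conj[OF u[OF \<beta>']] by (simp only:)
qed

section \<open>Directed automorphisms and states\<close>

lemma directed_eq_graft:
  assumes "\<omega> 0 \<noteq> b"
  shows "directed b \<alpha> \<omega> = graft [b] (directed b \<alpha> (seq_shift \<omega>)) \<circ> graft [\<omega> 0] \<alpha>"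
proof
  fix w show "directed b \<alpha> \<omega> w = (graft [b] (directed b \<alpha> (seq_shift \<omega>)) \<circ> graft [\<omega> 0] \<alpha>) w"
    using assms by (cases w) auto
qed

lemma directed_comp: "directed b (\<alpha> \<circ> \<beta>) \<omega> = directed b \<alpha> \<omega> \<circ> directed b \<beta> \<omega>"
proof
  fix w show "directed b (\<alpha> \<circ> \<beta>) \<omega> w = (directed b \<alpha> \<omega> \<circ> directed b \<beta> \<omega>) w"
    by (induction w arbitrary: \<omega>) auto
qed

lemma directed_id: "directed b id \<omega> = id"
proof
  fix w show "directed b id \<omega> w = id w"
    by (induction w arbitrary: \<omega>) auto
qed

lemma directed_aut_inv:
  assumes "\<alpha> \<in> tree_auts"
  shows "directed b (aut_inv \<alpha>) \<omega> = aut_inv (directed b \<alpha> \<omega>)"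
  by (rule inv_unique_comp[symmetric])
    (use assms in \<open>simp_all add: directed_id flip: directed_comp\<close>)

lemma subgroup_directed:
  assumes H: "subgroup H aut_tree"
  shows "subgroup {\<beta> \<in> tree_auts. directed b \<beta> \<omega> \<in> H} aut_tree"
  by (rule subgroup_aut_treeI)
    (use subgroup_aut_treeD[OF H] in
      \<open>auto simp: directed_comp directed_aut_inv directed_id tree_auts_comp tree_auts_inv\<close>)

lemma state_comp:
  assumes "\<alpha> \<in> tree_auts" "\<beta> \<in> tree_auts"
  shows "state (\<alpha> \<circ> \<beta>) x = state \<alpha> (level_perm \<beta> x) \<circ> state \<beta> x"
  using assms by (auto simp: fun_eq_iff tree_aut_Cons state_def[of "\<alpha> \<circ> \<beta>"])

lemma state_id [simp]: "state id x = id"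
  by (auto simp: state_def fun_eq_iff)

lemma state_aut_inv:
  assumes "\<alpha> \<in> tree_auts"
  shows "state (aut_inv \<alpha>) x = aut_inv (state \<alpha> (level_perm (aut_inv \<alpha>) x))"
proof -
  let ?y = "level_perm (aut_inv \<alpha>) x"
  note i = tree_auts_inv[OF assms]
  have "state \<alpha> ?y \<circ> state (aut_inv \<alpha>) x = id"
    using state_comp[OF assms i, of x] assms by simp
  then have "aut_inv (state \<alpha> ?y) \<circ> (state \<alpha> ?y \<circ> state (aut_inv \<alpha>) x) = aut_inv (state \<alpha> ?y)" by simp
  then show ?thesis using state_tree_aut[OF assms, of ?y] by (simp add: fun_eq_iff)
qed

lemma subgroup_states:
  assumes H: "subgroup H aut_tree"
  shows "subgroup {\<alpha> \<in> tree_auts. \<forall>x. state \<alpha> x \<in> H} aut_tree"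
  by (rule subgroup_aut_treeI)
    (use subgroup_aut_treeD[OF H] in \<open>auto simp: tree_auts_comp tree_auts_inv state_comp state_aut_inv\<close>)

text \<open>
  An automorphism that fixes the first level is the product of the grafts of its states; the
  product is taken one letter at a time, which is where the finiteness of the alphabet enters.
\<close>
lemma level_stab_in_subgroup_letter:
  fixes \<alpha> :: "'x::finite list \<Rightarrow> 'x list"
  assumes M: "subgroup M aut_tree" and a: "\<alpha> \<in> tree_auts" and lp: "\<And>x. level_perm \<alpha> x = x"
    and "\<And>x. graft [x] (state \<alpha> x) \<in> M"
  shows "\<alpha> \<in> M"
proof -
  define f where "f S w = (case w of [] \<Rightarrow> [] | x # w' \<Rightarrow> x # (if x \<in> S then state \<alpha> x w' else w'))"
    for S w
  have "f S \<in> M" if "finite S" for S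
    using that
  proof (induction S)
    case empty
    have "f {} = id" by (auto simp: f_def fun_eq_iff split: list.split)
    then show ?case using subgroup_aut_treeD(2)[OF M] by (simp only:)
  next
    case (insert x S)
    have "f (insert x S) = graft [x] (state \<alpha> x) \<circ> f S"
      using insert(2) by (auto simp: f_def fun_eq_iff split: list.split)
    then show ?case using subgroup_aut_treeD(3)[OF M assms(4) insert(3)] by (simp only:)
  qed
  moreover have "f UNIV = \<alpha>"
  proof
    fix w show "f UNIV w = \<alpha> w"
      using a by (cases w) (auto simp: f_def tree_aut_Cons lp, simp add: tree_auts_def)
  qed
  ultimately show ?thesis by (metis finite)
qed

section \<open>The branch structure of the groups\<close>

locale perfect_H_group =
  fixes b :: "'x::finite" and G :: "('x list \<Rightarrow> 'x list) set"
  assumes subgroup_G: "subgroup G aut_tree"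
    and perfect_G: "derived aut_tree G = G"
    and self_similar_G: "self_similar G"
    and property_H_G: "property_H G"
begin

definition spines :: "(nat \<Rightarrow> 'x) set \<Rightarrow> bool" where
  "spines \<Omega> \<longleftrightarrow> \<Omega> \<noteq> {} \<and> \<Omega> \<subseteq> spine_seqs b"

definition shifts :: "nat \<Rightarrow> (nat \<Rightarrow> 'x) set \<Rightarrow> (nat \<Rightarrow> 'x) set" where
  "shifts n = image seq_shift ^^ n"

lemma shifts_simps [simp]: "shifts 0 \<Omega> = \<Omega>" "shifts (Suc n) \<Omega> = shifts n (seq_shift ` \<Omega>)"
  by (simp_all add: shifts_def funpow_Suc_right del: funpow.simps)

lemma spines_shift: "spines \<Omega> \<Longrightarrow> spines (seq_shift ` \<Omega>)"
  by (auto simp: spines_def spine_seqs_def seq_shift_def)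

lemma G_tree_aut: "g \<in> G \<Longrightarrow> g \<in> tree_auts"
  using subgroup_aut_treeD(1)[OF subgroup_G] .

lemma generators_tree_aut: "G \<union> {directed b g \<omega> | g \<omega>. g \<in> G \<and> \<omega> \<in> \<Omega>} \<subseteq> tree_auts"
  by (auto simp: G_tree_aut directed_tree_aut)

lemma subgroup_Gam: "subgroup (Gam b G \<Omega>) aut_tree"
  unfolding Gam_def using generators_tree_aut
  by (intro group.generate_is_subgroup[OF group_aut_tree]) simp

lemmas Gam_closed = subgroup_aut_treeD[OF subgroup_Gam]

lemma G_in_Gam: "g \<in> G \<Longrightarrow> g \<in> Gam b G \<Omega>"
  unfolding Gam_def by (intro generate.incl) blast

lemma directed_in_Gam: "g \<in> G \<Longrightarrow> \<omega> \<in> \<Omega> \<Longrightarrow> directed b g \<omega> \<in> Gam b G \<Omega>"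
  unfolding Gam_def by (intro generate.incl) blast

lemma Gam_leI:
  assumes "subgroup H aut_tree" "G \<subseteq> H" "\<And>g \<omega>. g \<in> G \<Longrightarrow> \<omega> \<in> \<Omega> \<Longrightarrow> directed b g \<omega> \<in> H"
  shows "Gam b G \<Omega> \<subseteq> H"
  unfolding Gam_def by (rule group.generate_subgroup_incl[OF group_aut_tree _ assms(1)]) (use assms in auto)

lemma G_leI:
  assumes "subgroup H aut_tree"
    and "\<And>\<alpha> \<beta> \<gamma>. \<lbrakk>\<alpha> \<in> G; \<beta> \<in> G; \<gamma> \<in> tree_auts; \<alpha> \<circ> \<beta> = \<gamma> \<circ> (\<beta> \<circ> \<alpha>)\<rbrakk> \<Longrightarrow> \<gamma> \<in> H"
  shows "G \<subseteq> H"
proof -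
  have "derived aut_tree G \<subseteq> H"
    by (rule derived_leI[OF _ assms(1)]) (use G_tree_aut in blast, rule assms(2))
  then show ?thesis by (simp only: perfect_G)
qed

lemma state_in_Gam:
  assumes \<gamma>: "\<gamma> \<in> Gam b G \<Omega>"
  shows "state \<gamma> x \<in> Gam b G (seq_shift ` \<Omega>)"
proof -
  have "Gam b G \<Omega> \<subseteq> {\<alpha> \<in> tree_auts. \<forall>x. state \<alpha> x \<in> Gam b G (seq_shift ` \<Omega>)}"
  proof (rule Gam_leI[OF subgroup_states[OF subgroup_Gam]])
    show "G \<subseteq> {\<alpha> \<in> tree_auts. \<forall>x. state \<alpha> x \<in> Gam b G (seq_shift ` \<Omega>)}"
      using self_similar_G by (auto simp: self_similar_def G_tree_aut intro: G_in_Gam)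
    fix g \<omega> assume g: "g \<in> G" "\<omega> \<in> \<Omega>"
    have "state (directed b g \<omega>) x
        = (if x = b then directed b g (seq_shift \<omega>) else if x = \<omega> 0 then g else id)" for x
      by (auto simp: state_def fun_eq_iff)
    then show "directed b g \<omega> \<in> {\<alpha> \<in> tree_auts. \<forall>x. state \<alpha> x \<in> Gam b G (seq_shift ` \<Omega>)}"
      using g by (auto simp: directed_tree_aut G_tree_aut Gam_closed(2) G_in_Gam directed_in_Gam)
  qed
  then show ?thesis using \<gamma> by blast
qed

text \<open>
  The commutator trick: property H moves one of the two places where a directed automorphism is
  supported and keeps the other, so that two such elements interact below the letter \<open>\<omega> 0\<close>
  only.
\<close>
lemma graft_spine_in_Gam:
  assumes \<Omega>: "spines \<Omega>" and \<omega>: "\<omega> \<in> \<Omega>" and g: "g \<in> G"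
  shows "graft [\<omega> 0] g \<in> Gam b G \<Omega>"
proof -
  let ?\<Gamma> = "Gam b G \<Omega>" and ?c = "\<omega> 0"
  have cb: "?c \<noteq> b" using \<Omega> \<omega> by (auto simp: spines_def spine_seqs_def)
  obtain k where k: "k \<in> G" "level_perm k ?c = ?c" "level_perm k b \<noteq> b"
    using property_H_G cb unfolding property_H_def by blast
  define \<delta> where "\<delta> = state k ?c"
  have kt: "k \<in> tree_auts" using k G_tree_aut by blast
  have \<delta>: "\<delta> \<in> G" "\<delta> \<in> tree_auts"
    using k self_similar_G G_tree_aut unfolding \<delta>_def self_similar_def by blast+
  have kb: "level_perm k b \<noteq> ?c"
  proof
    assume "level_perm k b = ?c"
    then have "k [b] = ?c # state k b []" "k [?c] = ?c # state k ?c []"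
      using k by (simp_all add: tree_aut_Cons[OF kt])
    moreover have "state k x [] = []" for x using state_tree_aut[OF kt, of x] by (simp add: tree_auts_def)
    ultimately have "k [b] = k [?c]" by simp
    then have "aut_inv k (k [b]) = aut_inv k (k [?c])" by simp
    then show False using cb kt by simp
  qed
  have "G \<subseteq> {\<beta> \<in> tree_auts. graft [?c] \<beta> \<in> ?\<Gamma>}"
  proof (rule G_leI[OF subgroup_graft[OF subgroup_Gam]])
    fix \<alpha> \<beta> \<gamma> assume ab: "\<alpha> \<in> G" "\<beta> \<in> G" and \<gamma>: "\<gamma> \<in> tree_auts" "\<alpha> \<circ> \<beta> = \<gamma> \<circ> (\<beta> \<circ> \<alpha>)"
    \<comment> \<open>Conjugating by \<open>k\<close> twists the state at \<open>\<omega> 0\<close> by \<open>\<delta>\<close>; starting from \<open>\<beta>'\<close>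
      makes it come out as \<open>\<beta>\<close>.\<close>
    define \<beta>' where "\<beta>' = aut_inv \<delta> \<circ> \<beta> \<circ> \<delta>"
    have \<beta>': "\<beta>' \<in> G" using ab \<delta> subgroup_aut_treeD[OF subgroup_G] by (simp add: \<beta>'_def)
    define A where "A = directed b \<alpha> \<omega>"
    define B where "B = k \<circ> directed b \<beta>' \<omega> \<circ> aut_inv k"
    have AB: "A \<in> ?\<Gamma>" "B \<in> ?\<Gamma>"
      unfolding A_def B_def by (intro Gam_closed(3,4) directed_in_Gam G_in_Gam ab \<beta>' \<omega> k(1))+
    define B' where "B' = state k b \<circ> directed b \<beta>' (seq_shift \<omega>) \<circ> aut_inv (state k b)"
    have "B = (k \<circ> graft [b] (directed b \<beta>' (seq_shift \<omega>)) \<circ> aut_inv k) \<circ> (k \<circ> graft [?c] \<beta>' \<circ> aut_inv k)"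
      unfolding B_def directed_eq_graft[of \<omega> b, OF cb] using kt by (simp add: fun_eq_iff)
    also have "k \<circ> graft [b] (directed b \<beta>' (seq_shift \<omega>)) \<circ> aut_inv k = graft [level_perm k b] B'"
      unfolding B'_def by (rule graft_conj) (simp_all add: kt state_tree_aut tree_aut_Cons)
    also have "k \<circ> graft [?c] \<beta>' \<circ> aut_inv k = graft [?c] (\<delta> \<circ> \<beta>' \<circ> aut_inv \<delta>)"
      by (rule graft_conj) (simp_all add: kt \<delta> tree_aut_Cons k \<delta>_def[symmetric])
    also have "\<delta> \<circ> \<beta>' \<circ> aut_inv \<delta> = \<beta>" using \<delta> by (simp add: \<beta>'_def fun_eq_iff)
    finally have B: "B = graft [level_perm k b] B' \<circ> graft [?c] \<beta>" .
    have A: "A = graft [b] (directed b \<alpha> (seq_shift \<omega>)) \<circ> graft [?c] \<alpha>"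
      unfolding A_def by (rule directed_eq_graft[of \<omega> b, OF cb])
    have "A \<circ> B = graft [?c] \<gamma> \<circ> (B \<circ> A)"
    proof
      fix w show "(A \<circ> B) w = (graft [?c] \<gamma> \<circ> (B \<circ> A)) w"
        using cb kb k(3) fun_cong[OF \<gamma>(2)] by (cases w) (auto simp: A B)
    qed
    then show "\<gamma> \<in> {\<beta> \<in> tree_auts. graft [?c] \<beta> \<in> ?\<Gamma>}"
      using commutator_in_subgroup[OF subgroup_Gam AB] \<gamma>(1) by simp
  qed
  then show ?thesis using g by blast
qed

text \<open>
  At the letter \<open>b\<close> it suffices to graft generators of \<open>\<Gamma>(L\<Omega>)\<close>. Elements of \<open>G\<close> are moved
  there from the first letter of a sequence, and the directed generators are what remains of
  directed automorphisms along sequences in \<open>\<Omega>\<close> once their part below that letter is removed.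
  Elements of \<open>G\<close> lie in \<open>\<Gamma>(L\<Omega>)\<close>, so the transport to the other letters stays in this group.
\<close>
lemma graft_letter_in_Gam:
  assumes \<Omega>: "spines \<Omega>" and \<beta>: "\<beta> \<in> Gam b G (seq_shift ` \<Omega>)"
  shows "graft [x] \<beta> \<in> Gam b G \<Omega>"
proof -
  let ?\<Gamma> = "Gam b G \<Omega>"
  let ?H = "{\<beta> \<in> tree_auts. graft [b] \<beta> \<in> ?\<Gamma>}"
  obtain \<omega>\<^sub>0 where \<omega>\<^sub>0: "\<omega>\<^sub>0 \<in> \<Omega>" using \<Omega> by (auto simp: spines_def)
  have move: "graft [y] \<beta> \<in> ?\<Gamma>"
    if K: "subgroup K aut_tree" "G \<subseteq> K" and x: "\<And>\<beta>. \<beta> \<in> K \<Longrightarrow> graft [x] \<beta> \<in> ?\<Gamma>" and \<beta>: "\<beta> \<in> K"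
    for K x y \<beta>
  proof -
    obtain k where k: "k \<in> G" "level_perm k x = y"
      using property_H_G unfolding property_H_def by blast
    have kt: "k \<in> tree_auts" using k G_tree_aut by blast
    show ?thesis
    proof (rule graft_transport[OF kt _ K(1) _ _ x \<beta>, of "state k x"])
      show "k \<circ> \<nu> \<circ> aut_inv k \<in> ?\<Gamma>" if "\<nu> \<in> ?\<Gamma>" for \<nu>
        by (intro Gam_closed(3,4) that G_in_Gam[OF k(1)])
      show "state k x \<in> K" using k(1) K(2) self_similar_G unfolding self_similar_def by blast
      show "k ([x] @ w) = [y] @ state k x w" for w using k(2) tree_aut_Cons[OF kt] by simp
    qed
  qed
  have G: "graft [b] g \<in> ?\<Gamma>" if g: "g \<in> G" for g
    by (rule move[OF subgroup_G _ graft_spine_in_Gam[OF \<Omega> \<omega>\<^sub>0] g]) simp_all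
  have "Gam b G (seq_shift ` \<Omega>) \<subseteq> ?H"
  proof (rule Gam_leI[OF subgroup_graft[OF subgroup_Gam]])
    show "G \<subseteq> ?H" using G G_tree_aut by blast
    fix g \<omega>' assume g: "g \<in> G" and "\<omega>' \<in> seq_shift ` \<Omega>"
    then obtain \<omega> where \<omega>: "\<omega> \<in> \<Omega>" "\<omega>' = seq_shift \<omega>" by blast
    have cb: "\<omega> 0 \<noteq> b" using \<Omega> \<omega> by (auto simp: spines_def spine_seqs_def)
    have gt: "g \<in> tree_auts" using g by (rule G_tree_aut)
    have "graft [b] (directed b g \<omega>') = directed b g \<omega> \<circ> graft [\<omega> 0] (aut_inv g)"
    proof
      fix w show "graft [b] (directed b g \<omega>') w = (directed b g \<omega> \<circ> graft [\<omega> 0] (aut_inv g)) w"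
        using gt cb by (cases w) (auto simp: \<omega>(2))
    qed
    moreover have "directed b g \<omega> \<circ> graft [\<omega> 0] (aut_inv g) \<in> ?\<Gamma>"
      by (intro Gam_closed(3) directed_in_Gam graft_spine_in_Gam \<Omega> \<omega>(1) g subgroup_aut_treeD(4)[OF subgroup_G])
    ultimately show "directed b g \<omega>' \<in> ?H" using directed_tree_aut[OF gt] by simp
  qed
  then have b: "graft [b] \<beta> \<in> ?\<Gamma>" if "\<beta> \<in> Gam b G (seq_shift ` \<Omega>)" for \<beta> using that by blast
  show ?thesis by (rule move[OF subgroup_Gam _ b \<beta>]) (use G_in_Gam in auto)
qed

lemma graft_in_Gam:
  "spines \<Omega> \<Longrightarrow> \<beta> \<in> Gam b G (shifts (length v) \<Omega>) \<Longrightarrow> graft v \<beta> \<in> Gam b G \<Omega>"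
proof (induction v arbitrary: \<Omega>)
  case (Cons x v)
  have "graft v \<beta> \<in> Gam b G (seq_shift ` \<Omega>)"
    by (rule Cons.IH[OF spines_shift[OF Cons.prems(1)]]) (use Cons.prems(2) in simp)
  then show ?case unfolding graft_Cons[of x v] by (rule graft_letter_in_Gam[OF Cons.prems(1)])
qed simp

lemma section_in_Gam:
  "\<gamma> \<in> Gam b G \<Omega> \<Longrightarrow> \<exists>\<delta>\<in>Gam b G (shifts (length u) \<Omega>). \<forall>w. \<gamma> (u @ w) = \<gamma> u @ \<delta> w"
proof (induction u arbitrary: \<gamma> \<Omega>)
  case Nil
  then have "\<gamma> [] = []" using Gam_closed(1)[OF Nil] by (simp add: tree_auts_def)
  then show ?case using Nil by (intro bexI[of _ \<gamma>]) simp_all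
next
  case (Cons x u)
  obtain \<delta> where "\<delta> \<in> Gam b G (shifts (length u) (seq_shift ` \<Omega>))"
    "\<forall>w. state \<gamma> x (u @ w) = state \<gamma> x u @ \<delta> w"
    using Cons.IH[OF state_in_Gam[OF Cons.prems]] by blast
  then show ?case by (intro bexI[of _ \<delta>]) (simp_all add: tree_aut_Cons[OF Gam_closed(1)[OF Cons.prems]])
qed

text \<open>
  Transitivity of \<open>G\<close> on letters adjusts the first letter; the rest is adjusted by a graft below
  it.
\<close>
lemma level_transitive_Gam:
  "spines \<Omega> \<Longrightarrow> length u = length v \<Longrightarrow> \<exists>\<gamma>\<in>Gam b G \<Omega>. \<gamma> u = v"
proof (induction u arbitrary: v \<Omega>)
  case Nil
  then show ?case using Gam_closed(2)[of \<Omega>] by (intro bexI[of _ id]) auto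
next
  case (Cons x u)
  then obtain y v' where v: "v = y # v'" "length u = length v'" by (cases v) auto
  obtain k where k: "k \<in> G" "level_perm k x = y"
    using property_H_G unfolding property_H_def by blast
  have kt: "k \<in> tree_auts" using k G_tree_aut by blast
  define \<delta> where "\<delta> = state k x"
  have \<delta>: "\<delta> \<in> Gam b G (seq_shift ` \<Omega>)"
    unfolding \<delta>_def by (intro state_in_Gam G_in_Gam k(1))
  obtain \<gamma>\<^sub>0 where \<gamma>\<^sub>0: "\<gamma>\<^sub>0 \<in> Gam b G (seq_shift ` \<Omega>)" "\<gamma>\<^sub>0 u = v'"
    using Cons.IH[OF spines_shift[OF Cons.prems(1)] v(2)] by blast
  define \<gamma> where "\<gamma> = \<gamma>\<^sub>0 \<circ> aut_inv \<delta>"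
  have \<gamma>: "\<gamma> \<in> Gam b G (seq_shift ` \<Omega>)" "\<gamma> (state k x u) = v'"
    unfolding \<delta>_def[symmetric] \<gamma>_def
    by (intro Gam_closed(3,4) \<gamma>\<^sub>0(1) \<delta>) (simp add: \<gamma>\<^sub>0(2) Gam_closed(1)[OF \<delta>])
  have "graft [y] \<gamma> \<circ> k \<in> Gam b G \<Omega>"
    by (intro Gam_closed(3) G_in_Gam k(1) graft_letter_in_Gam Cons.prems(1) \<gamma>(1))
  moreover have "(graft [y] \<gamma> \<circ> k) (x # u) = v" using k \<gamma> v by (simp add: tree_aut_Cons[OF kt])
  ultimately show ?case by blast
qed

text \<open>
  For fixed \<open>\<omega>\<close> the map \<open>g \<mapsto> directed b g \<omega>\<close> is multiplicative, so \<open>\<Gamma>(\<Omega>)\<close> is generated by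
  homomorphic images of the perfect group \<open>G\<close>.
\<close>
lemma derived_Gam: "derived aut_tree (Gam b G \<Omega>) = Gam b G \<Omega>"
proof
  show "derived aut_tree (Gam b G \<Omega>) \<subseteq> Gam b G \<Omega>"
    by (rule group.derived_incl[OF group_aut_tree]) (simp_all add: subgroup_Gam)
  have D: "subgroup (derived aut_tree (Gam b G \<Omega>)) aut_tree" (is "subgroup ?D _")
    by (rule group.derived_is_subgroup[OF group_aut_tree]) (simp add: subsetI Gam_closed(1)[of _ \<Omega>])
  have comm: "\<gamma> \<in> ?D" if "\<alpha> \<in> Gam b G \<Omega>" "\<beta> \<in> Gam b G \<Omega>" "\<alpha> \<circ> \<beta> = \<gamma> \<circ> (\<beta> \<circ> \<alpha>)" for \<alpha> \<beta> \<gamma>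
  proof -
    have t: "\<alpha> \<in> tree_auts" "\<beta> \<in> tree_auts" using that Gam_closed(1) by blast+
    then have "\<gamma> = \<alpha> \<circ> \<beta> \<circ> aut_inv \<alpha> \<circ> aut_inv \<beta>" by (simp add: that(3) fun_eq_iff)
    then have "\<gamma> = \<alpha> \<otimes>\<^bsub>aut_tree\<^esub> \<beta> \<otimes>\<^bsub>aut_tree\<^esub> inv\<^bsub>aut_tree\<^esub> \<alpha> \<otimes>\<^bsub>aut_tree\<^esub> inv\<^bsub>aut_tree\<^esub> \<beta>"
      using t by simp
    then show ?thesis unfolding derived_def using that by (intro generate.incl) blast
  qed
  show "Gam b G \<Omega> \<subseteq> ?D"
  proof (rule Gam_leI[OF D])
    show "G \<subseteq> ?D" by (rule G_leI[OF D]) (use comm G_in_Gam in blast)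
    fix g \<omega> assume g: "g \<in> G" "\<omega> \<in> \<Omega>"
    have "G \<subseteq> {\<beta> \<in> tree_auts. directed b \<beta> \<omega> \<in> ?D}"
    proof (rule G_leI[OF subgroup_directed[OF D]])
      fix \<alpha> \<beta> \<gamma> assume "\<alpha> \<in> G" "\<beta> \<in> G" "\<gamma> \<in> tree_auts" and e: "\<alpha> \<circ> \<beta> = \<gamma> \<circ> (\<beta> \<circ> \<alpha>)"
      moreover have "directed b \<alpha> \<omega> \<circ> directed b \<beta> \<omega>
          = directed b \<gamma> \<omega> \<circ> (directed b \<beta> \<omega> \<circ> directed b \<alpha> \<omega>)"
        by (simp add: e flip: directed_comp)
      ultimately show "\<gamma> \<in> {\<beta> \<in> tree_auts. directed b \<beta> \<omega> \<in> ?D}"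
        using comm directed_in_Gam g(2) by blast
    qed
    then show "directed b g \<omega> \<in> ?D" using g by blast
  qed
qed

lemma Gam_leI_commutators:
  assumes "subgroup H aut_tree"
    and "\<And>\<alpha> \<beta> \<gamma>. \<lbrakk>\<alpha> \<in> Gam b G \<Omega>; \<beta> \<in> Gam b G \<Omega>; \<gamma> \<in> tree_auts; \<alpha> \<circ> \<beta> = \<gamma> \<circ> (\<beta> \<circ> \<alpha>)\<rbrakk> \<Longrightarrow> \<gamma> \<in> H"
  shows "Gam b G \<Omega> \<subseteq> H"
proof -
  have "derived aut_tree (Gam b G \<Omega>) \<subseteq> H"
    by (rule derived_leI[OF _ assms(1)]) (use Gam_closed(1) in blast, rule assms(2))
  then show ?thesis by (simp only: derived_Gam)
qed

text \<open>
  For the induction \<open>M\<close> has to vary: below the letter \<open>x\<close> it is replaced by the group of those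
  automorphisms whose graft at \<open>x\<close> lies in \<open>M\<close>.
\<close>
lemma level_stab_generated_by_grafts:
  assumes "subgroup M aut_tree" "\<alpha> \<in> Gam b G \<Omega>" "\<alpha> \<in> level_stab n" "spines \<Omega>"
    and "\<And>v \<beta>. length v = n \<Longrightarrow> \<beta> \<in> Gam b G (shifts n \<Omega>) \<Longrightarrow> graft v \<beta> \<in> M"
  shows "\<alpha> \<in> M"
  using assms
proof (induction n arbitrary: M \<alpha> \<Omega>)
  case 0
  from 0(5)[of "[]" \<alpha>] 0(2) show ?case by simp
next
  case (Suc n)
  have a: "\<alpha> \<in> tree_auts" using Suc.prems Gam_closed(1) by blast
  have fixed: "level_perm \<alpha> x # state \<alpha> x w = x # w" if "length w = n" for x w
    using Suc.prems(3) that tree_aut_Cons[OF a, of x w] by (simp add: level_stab_def)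
  show ?case
  proof (rule level_stab_in_subgroup_letter[OF Suc.prems(1) a])
    show "level_perm \<alpha> x = x" for x using fixed[of "replicate n x" x] by simp
    fix x
    have "state \<alpha> x \<in> {\<beta> \<in> tree_auts. graft [x] \<beta> \<in> M}"
    proof (rule Suc.IH[OF subgroup_graft[OF Suc.prems(1)] state_in_Gam[OF Suc.prems(2)]])
      show "spines (seq_shift ` \<Omega>)" by (rule spines_shift[OF Suc.prems(4)])
      show "state \<alpha> x \<in> level_stab n" using fixed state_tree_aut[OF a] by (simp add: level_stab_def)
      fix v :: "'x list" and \<beta> assume v: "length v = n" "\<beta> \<in> Gam b G (shifts n (seq_shift ` \<Omega>))"
      have "graft (x # v) \<beta> \<in> M" by (rule Suc.prems(5)) (use v in simp_all)
      moreover have "graft v \<beta> \<in> tree_auts"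
        using graft_in_Gam[OF spines_shift[OF Suc.prems(4)]] v Gam_closed(1) by blast
      ultimately show "graft v \<beta> \<in> {\<beta> \<in> tree_auts. graft [x] \<beta> \<in> M}" by (simp flip: graft_Cons)
    qed
    then show "graft [x] (state \<alpha> x) \<in> M" by simp
  qed
qed

section \<open>Normal subgroups contain level stabilizers\<close>

text \<open>
  Let \<open>\<gamma> \<in> N\<close> move the vertex \<open>u\<close>, and let \<open>\<alpha>\<close> be grafted at \<open>u\<close>. The element \<open>\<nu>\<close>, a
  commutator of this graft with the inverse of \<open>\<gamma>\<close>, lies in \<open>N\<close> and still acts as \<open>\<alpha>\<close> below
  \<open>u\<close>, because the correcting conjugate acts below another vertex. Its commutator with a graft
  of \<open>\<beta>\<close> at \<open>u\<close> is therefore the graft of the commutator of \<open>\<alpha>\<close> and \<open>\<beta>\<close>. As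
  \<open>\<Gamma>(L\<^sup>n\<Omega>)\<close> is perfect, these generate all grafts at \<open>u\<close>.
\<close>
lemma normal_contains_level_stab:
  assumes \<Omega>: "spines \<Omega>" and N: "subgroup N aut_tree" "N \<subseteq> Gam b G \<Omega>" "N \<noteq> {id}"
    and conj: "\<And>\<gamma> \<nu>. \<gamma> \<in> Gam b G \<Omega> \<Longrightarrow> \<nu> \<in> N \<Longrightarrow> \<gamma> \<circ> \<nu> \<circ> aut_inv \<gamma> \<in> N"
  shows "\<exists>n. Gam b G \<Omega> \<inter> level_stab n \<subseteq> N"
proof -
  note Nc = subgroup_aut_treeD[OF N(1)]
  obtain \<gamma> u where \<gamma>: "\<gamma> \<in> N" "\<gamma> u \<noteq> u" using N(3) Nc(2) by fastforce
  have gt: "\<gamma> \<in> tree_auts" using \<gamma> Nc by blast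
  define n where "n = length u"
  let ?\<Gamma>n = "Gam b G (shifts n \<Omega>)"
  have "?\<Gamma>n \<subseteq> {\<beta> \<in> tree_auts. graft u \<beta> \<in> N}"
  proof (rule Gam_leI_commutators[OF subgroup_graft[OF N(1)]])
    fix \<alpha> \<beta> \<kappa> assume ab: "\<alpha> \<in> ?\<Gamma>n" "\<beta> \<in> ?\<Gamma>n" and k: "\<kappa> \<in> tree_auts" "\<alpha> \<circ> \<beta> = \<kappa> \<circ> (\<beta> \<circ> \<alpha>)"
    have at: "\<alpha> \<in> tree_auts" using ab Gam_closed by blast
    have A: "graft u \<alpha> \<in> Gam b G \<Omega>" and B: "graft u \<beta> \<in> Gam b G \<Omega>"
      using ab graft_in_Gam[OF \<Omega>] by (simp_all add: n_def)
    define \<nu> where "\<nu> = graft u \<alpha> \<circ> aut_inv \<gamma> \<circ> aut_inv (graft u \<alpha>) \<circ> \<gamma>"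
    have \<nu>: "\<nu> \<in> N" unfolding \<nu>_def using conj[OF A] Nc \<gamma>(1) by blast
    have \<nu>u: "\<nu> (u @ w) = u @ \<alpha> w" for w
    proof -
      obtain w' where w': "\<gamma> (u @ w) = \<gamma> u @ w'" using tree_auts_append[OF gt] by blast
      have "\<gamma> (u @ w) \<noteq> u @ s" for s
        using w' \<gamma>(2) length_tree_aut[OF gt, of u] by simp
      then have "aut_inv (graft u \<alpha>) (\<gamma> (u @ w)) = \<gamma> (u @ w)"
        unfolding graft_aut_inv[OF at, symmetric] by (rule graft_outside)
      then show ?thesis using gt by (simp add: \<nu>_def)
    qed
    have "\<nu> \<circ> graft u \<beta> = graft u \<kappa> \<circ> (graft u \<beta> \<circ> \<nu>)"
    proof
      fix w show "(\<nu> \<circ> graft u \<beta>) w = (graft u \<kappa> \<circ> (graft u \<beta> \<circ> \<nu>)) w"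
      proof (cases "\<exists>s. w = u @ s")
        case True
        then show ?thesis using fun_cong[OF k(2)] by (auto simp: \<nu>u)
      next
        case False
        have "\<nu> w \<noteq> u @ s" for s
        proof
          assume "\<nu> w = u @ s"
          then have "\<nu> w = \<nu> (u @ aut_inv \<alpha> s)" using at by (simp add: \<nu>u)
          then have "w = u @ aut_inv \<alpha> s" using Nc(1)[OF \<nu>] by (metis aut_inv_simps(2))
          then show False using False by blast
        qed
        then show ?thesis using False by (simp add: graft_outside)
      qed
    qed
    then have "graft u \<kappa> = \<nu> \<circ> (graft u \<beta> \<circ> aut_inv \<nu> \<circ> aut_inv (graft u \<beta>))"
      using Nc(1)[OF \<nu>] Gam_closed(1)[OF B] by (simp add: fun_eq_iff)
    then have "graft u \<kappa> \<in> N" using conj[OF B Nc(4)[OF \<nu>]] Nc(3)[OF \<nu>] by metis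
    then show "\<kappa> \<in> {\<beta> \<in> tree_auts. graft u \<beta> \<in> N}" using k by simp
  qed
  then have u: "graft u \<beta> \<in> N" if "\<beta> \<in> ?\<Gamma>n" for \<beta> using that by blast
  have v: "graft v \<beta> \<in> N" if \<beta>: "\<beta> \<in> ?\<Gamma>n" and lv: "length v = n" for v \<beta>
  proof -
    obtain \<tau> where \<tau>: "\<tau> \<in> Gam b G \<Omega>" "\<tau> u = v"
      using level_transitive_Gam[OF \<Omega>] lv n_def by metis
    obtain \<delta> where \<delta>: "\<delta> \<in> ?\<Gamma>n" "\<And>w. \<tau> (u @ w) = v @ \<delta> w"
      using section_in_Gam[OF \<tau>(1), of u] \<tau>(2) n_def by auto
    show ?thesis
      by (rule graft_transport[OF _ _ subgroup_Gam \<delta> u \<beta>]) (use Gam_closed(1)[OF \<tau>(1)] conj[OF \<tau>(1)] in auto)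
  qed
  have "Gam b G \<Omega> \<inter> level_stab n \<subseteq> N"
    using level_stab_generated_by_grafts[OF N(1) _ _ \<Omega>] v by blast
  then show ?thesis ..
qed

end

section \<open>The congruence topology\<close>

lemma tree_auts_agree_below:
  fixes \<alpha> \<beta> :: "'x list \<Rightarrow> 'x list"
  assumes a: "\<alpha> \<in> tree_auts" and b: "\<beta> \<in> tree_auts"
    and ab: "\<And>w. length w = l \<Longrightarrow> \<alpha> w = \<beta> w" and w: "length w \<le> l"
  shows "\<alpha> w = \<beta> w"
proof -
  define v where "v = replicate (l - length w) (undefined :: 'x)"
  obtain v' where v': "\<alpha> (w @ v) = \<alpha> w @ v'" using tree_auts_append[OF a] by blast
  obtain v'' where v'': "\<beta> (w @ v) = \<beta> w @ v''" using tree_auts_append[OF b] by blast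
  have "\<alpha> (w @ v) = \<beta> (w @ v)" using w by (intro ab) (simp add: v_def)
  then show ?thesis using length_tree_aut[OF a, of w] length_tree_aut[OF b, of w] v' v'' by simp
qed

text \<open>
  The automorphism group is closed under pointwise limits: each clause in the definition of an
  automorphism concerns only finitely many levels at a time. Surjectivity uses that
  automorphisms preserve levels.
\<close>
lemma tree_auts_limit:
  fixes f :: "'x list \<Rightarrow> 'x list"
  assumes f: "\<And>l. \<exists>\<gamma>\<in>tree_auts. \<forall>w. length w \<le> l \<longrightarrow> f w = \<gamma> w"
  shows "f \<in> tree_auts"
proof -
  have len: "length (f w) = length w" for w
    using f[of "length w"] by (metis length_tree_aut order_refl)
  have "inj f"
  proof (rule injI)
    fix u v assume e: "f u = f v"
    obtain \<gamma> where \<gamma>: "\<gamma> \<in> tree_auts" "\<And>w. length w \<le> max (length u) (length v) \<Longrightarrow> f w = \<gamma> w"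
      using f by metis
    then have "\<gamma> u = \<gamma> v" using e by simp
    then show "u = v" using aut_inv_simps(2)[OF \<gamma>(1)] by metis
  qed
  moreover have "\<exists>w. v = f w" for v
  proof -
    obtain \<gamma> where \<gamma>: "\<gamma> \<in> tree_auts" "\<And>w. length w \<le> length v \<Longrightarrow> f w = \<gamma> w"
      using f by metis
    have "v = f (aut_inv \<gamma> v)"
      using \<gamma>(2)[of "aut_inv \<gamma> v"] length_tree_aut[OF tree_auts_inv[OF \<gamma>(1)], of v] \<gamma>(1) by simp
    then show ?thesis by blast
  qed
  moreover have "tree_edge (f u) (f v) \<longleftrightarrow> tree_edge u v" for u v
  proof -
    obtain \<gamma> where \<gamma>: "\<gamma> \<in> tree_auts" "\<And>w. length w \<le> max (length u) (length v) \<Longrightarrow> f w = \<gamma> w"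
      using f by metis
    then show ?thesis by (simp add: tree_auts_def)
  qed
  moreover have "f [] = []" using len[of "[]"] by simp
  ultimately show ?thesis by (simp add: tree_auts_def bij_def surj_def)
qed

lemma topspace_aut_topology [simp]: "topspace aut_topology = tree_auts"
proof -
  have "openin aut_topology (tree_auts :: ('x list \<Rightarrow> 'x list) set)"
    by (auto simp: openin_aut_topology l_coset_def level_stab_def tree_auts_comp)
  then show ?thesis using openin_aut_topology openin_topspace by (metis openin_subset subset_antisym)
qed

definition level_ball :: "('x list \<Rightarrow> 'x list) \<Rightarrow> nat \<Rightarrow> ('x list \<Rightarrow> 'x list) set" where
  "level_ball \<alpha> l = {\<beta> \<in> tree_auts. \<forall>w. length w = l \<longrightarrow> \<beta> w = \<alpha> w}"

lemma level_ball_eq_coset: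
  assumes a: "\<alpha> \<in> tree_auts"
  shows "\<alpha> <#\<^bsub>aut_tree\<^esub> level_stab l = level_ball \<alpha> l"
proof
  show "\<alpha> <#\<^bsub>aut_tree\<^esub> level_stab l \<subseteq> level_ball \<alpha> l"
    using a by (auto simp: l_coset_def level_stab_def level_ball_def tree_auts_comp)
  show "level_ball \<alpha> l \<subseteq> \<alpha> <#\<^bsub>aut_tree\<^esub> level_stab l"
  proof
    fix \<beta> assume b: "\<beta> \<in> level_ball \<alpha> l"
    have "aut_inv \<alpha> \<circ> \<beta> \<in> level_stab l" "\<beta> = \<alpha> \<circ> (aut_inv \<alpha> \<circ> \<beta>)"
      using a b by (auto simp: level_stab_def level_ball_def tree_auts_comp tree_auts_inv fun_eq_iff)
    then show "\<beta> \<in> \<alpha> <#\<^bsub>aut_tree\<^esub> level_stab l" unfolding l_coset_def aut_tree_simps by blast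
  qed
qed

lemma openin_aut_topology_ball:
  "openin aut_topology U \<longleftrightarrow> U \<subseteq> tree_auts \<and> (\<forall>\<alpha>\<in>U. \<exists>l. level_ball \<alpha> l \<subseteq> U)"
  unfolding openin_aut_topology using level_ball_eq_coset by (metis subsetD)

lemma openin_level_ball: "openin aut_topology (level_ball \<alpha> l)"
  by (auto simp: openin_aut_topology_ball level_ball_def intro!: exI[of _ l])

lemma in_tree_closure_iff:
  "\<alpha> \<in> tree_closure \<Gamma> \<longleftrightarrow> \<alpha> \<in> tree_auts \<and> (\<forall>l. \<exists>\<gamma>\<in>\<Gamma>. \<gamma> \<in> level_ball \<alpha> l)"
proof
  assume a: "\<alpha> \<in> tree_closure \<Gamma>"
  then have t: "\<alpha> \<in> tree_auts" by (simp add: tree_closure_def in_closure_of)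
  then have "\<alpha> \<in> level_ball \<alpha> l" for l by (simp add: level_ball_def)
  then show "\<alpha> \<in> tree_auts \<and> (\<forall>l. \<exists>\<gamma>\<in>\<Gamma>. \<gamma> \<in> level_ball \<alpha> l)"
    using a t openin_level_ball unfolding tree_closure_def in_closure_of by blast
next
  assume "\<alpha> \<in> tree_auts \<and> (\<forall>l. \<exists>\<gamma>\<in>\<Gamma>. \<gamma> \<in> level_ball \<alpha> l)"
  then show "\<alpha> \<in> tree_closure \<Gamma>"
    unfolding tree_closure_def in_closure_of topspace_aut_topology openin_aut_topology_ball by blast
qed

lemma rcoset_aut_tree: "N #>\<^bsub>aut_tree\<^esub> \<gamma> = (\<lambda>\<nu>. \<nu> \<circ> \<gamma>) ` N"
  by (auto simp: r_coset_def)

lemmas rcoset_S = r_coset_consistent rcoset_aut_tree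

section \<open>Level stabilizers in a subgroup\<close>

locale tree_group =
  fixes \<Gamma> :: "('x::finite list \<Rightarrow> 'x list) set"
  assumes subgroup_\<Gamma>: "subgroup \<Gamma> aut_tree"
begin

abbreviation S :: "('x list \<Rightarrow> 'x list) monoid" where
  "S \<equiv> aut_tree\<lparr>carrier := \<Gamma>\<rparr>"

definition level_kernel :: "nat \<Rightarrow> ('x list \<Rightarrow> 'x list) set" where
  "level_kernel l = \<Gamma> \<inter> level_stab l"

lemmas \<Gamma>_closed = subgroup_aut_treeD[OF subgroup_\<Gamma>]

lemma group_S: "group S"
  by (rule group.subgroup_imp_group[OF group_aut_tree subgroup_\<Gamma>])

lemma inv_S: "\<gamma> \<in> \<Gamma> \<Longrightarrow> inv\<^bsub>S\<^esub> \<gamma> = aut_inv \<gamma>"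
  using group.m_inv_consistent[OF group_aut_tree subgroup_\<Gamma>] \<Gamma>_closed(1) by simp

lemma normal_S_iff:
  "N \<lhd> S \<longleftrightarrow> subgroup N aut_tree \<and> N \<subseteq> \<Gamma> \<and> (\<forall>\<gamma>\<in>\<Gamma>. \<forall>\<nu>\<in>N. \<gamma> \<circ> \<nu> \<circ> aut_inv \<gamma> \<in> N)"
proof -
  have "subgroup N S \<longleftrightarrow> subgroup N aut_tree \<and> N \<subseteq> \<Gamma>"
    using group.incl_subgroup[OF group_aut_tree subgroup_\<Gamma>] subgroup.subset
      group.subgroup_incl[OF group_aut_tree _ subgroup_\<Gamma>] by fastforce
  then show ?thesis using inv_S by (auto simp: group.normal_inv_iff[OF group_S])
qed

lemma carrier_Mod_S: "carrier (S Mod N) = (\<lambda>\<gamma>. N #>\<^bsub>S\<^esub> \<gamma>) ` \<Gamma>"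
  by (auto simp: FactGroup_def RCOSETS_def)

lemma rcoset_eqI:
  assumes N: "N \<lhd> S" and "\<gamma> \<in> \<Gamma>" "\<delta> \<in> N #>\<^bsub>S\<^esub> \<gamma>"
  shows "\<delta> \<in> \<Gamma>" "N #>\<^bsub>S\<^esub> \<gamma> = N #>\<^bsub>S\<^esub> \<delta>"
proof -
  show "\<delta> \<in> \<Gamma>" using assms \<Gamma>_closed(3) by (auto simp: rcoset_S normal_S_iff)
  show "N #>\<^bsub>S\<^esub> \<gamma> = N #>\<^bsub>S\<^esub> \<delta>"
    using group.repr_independence[OF group_S assms(3) _ normal_imp_subgroup[OF N]] assms(2) by simp
qed

lemma rcoset_self:
  assumes "N \<lhd> S"
  shows "\<gamma> \<in> N #>\<^bsub>S\<^esub> \<gamma>"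
  proof -
  have "id \<in> N" using assms subgroup_aut_treeD(2) unfolding normal_S_iff by blast
  then show ?thesis unfolding rcoset_S by (rule rev_image_eqI) simp
qed

lemma agree_in_rcoset:
  assumes N: "level_kernel l \<subseteq> N" and g: "\<gamma> \<in> \<Gamma>" "\<delta> \<in> \<Gamma>"
    and e: "\<And>w. length w = l \<Longrightarrow> \<gamma> w = \<delta> w"
  shows "\<delta> \<in> N #>\<^bsub>S\<^esub> \<gamma>"
proof -
  have t: "\<gamma> \<in> tree_auts" "\<delta> \<in> tree_auts" using g \<Gamma>_closed(1) by blast+
  have "\<delta> \<circ> aut_inv \<gamma> \<in> level_kernel l"
    using g t e[symmetric] length_tree_aut[OF tree_auts_inv[OF t(1)]]
    by (auto simp: level_kernel_def level_stab_def tree_auts_comp tree_auts_inv intro!: \<Gamma>_closed(3,4))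
  moreover have "\<delta> = (\<delta> \<circ> aut_inv \<gamma>) \<circ> \<gamma>" using t by (simp add: fun_eq_iff)
  ultimately show ?thesis using N unfolding rcoset_S by blast
qed

lemma agree_rcoset_eq:
  assumes "N \<lhd> S" "level_kernel l \<subseteq> N" "\<gamma> \<in> \<Gamma>" "\<delta> \<in> \<Gamma>" "\<And>w. length w = l \<Longrightarrow> \<gamma> w = \<delta> w"
  shows "N #>\<^bsub>S\<^esub> \<gamma> = N #>\<^bsub>S\<^esub> \<delta>"
  using rcoset_eqI(2)[OF assms(1,3) agree_in_rcoset[OF assms(2-5)]] by blast

lemma normal_level_kernel: "level_kernel l \<lhd> S"
proof -
  have "subgroup (level_kernel l) aut_tree"
    by (rule subgroup_aut_treeI)
      (auto simp: level_kernel_def level_stab_def tree_auts_comp tree_auts_inv \<Gamma>_closed(2-4), metis aut_inv_simps(2))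
  moreover have "\<gamma> \<circ> \<nu> \<circ> aut_inv \<gamma> \<in> level_kernel l" if g: "\<gamma> \<in> \<Gamma>" and n: "\<nu> \<in> level_kernel l" for \<gamma> \<nu>
  proof -
    have t: "\<gamma> \<in> tree_auts" using g \<Gamma>_closed(1) by blast
    have "\<gamma> \<circ> \<nu> \<circ> aut_inv \<gamma> \<in> \<Gamma>" using g n by (intro \<Gamma>_closed(3,4)) (auto simp: level_kernel_def)
    moreover have "(\<gamma> \<circ> \<nu> \<circ> aut_inv \<gamma>) w = w" if "length w = l" for w
      using n t length_tree_aut[OF tree_auts_inv[OF t], of w] that by (simp add: level_kernel_def level_stab_def)
    ultimately show ?thesis using \<Gamma>_closed(1) by (simp add: level_kernel_def level_stab_def)
  qed
  ultimately show ?thesis by (auto simp: normal_S_iff level_kernel_def)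
qed

text \<open>
  A coset of \<open>N\<close> depends only on the action of a representative on level \<open>l\<close>, a finite
  set.
\<close>
lemma finite_index_of_level_stab:
  assumes N: "N \<lhd> S" "level_kernel l \<subseteq> N"
  shows "finite (carrier (S Mod N))"
proof -
  let ?W = "{w :: 'x list. length w = l}"
  have W: "finite ?W" using finite_lists_length_eq[of "UNIV :: 'x set" l] by simp
  define r where "r \<gamma> = restrict \<gamma> ?W" for \<gamma> :: "'x list \<Rightarrow> 'x list"
  have "r \<gamma> \<in> ?W \<rightarrow>\<^sub>E ?W" if "\<gamma> \<in> \<Gamma>" for \<gamma>
    using length_tree_aut[OF \<Gamma>_closed(1)[OF that]] by (auto simp: r_def)
  then have "r ` \<Gamma> \<subseteq> ?W \<rightarrow>\<^sub>E ?W" by blast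
  then have fin: "finite (r ` \<Gamma>)" using W by (meson finite_PiE finite_subset)
  have eq: "N #>\<^bsub>S\<^esub> \<gamma> = N #>\<^bsub>S\<^esub> \<delta>" if "\<gamma> \<in> \<Gamma>" "\<delta> \<in> \<Gamma>" "r \<gamma> = r \<delta>" for \<gamma> \<delta>
    by (rule agree_rcoset_eq[OF N that(1,2)]) (use fun_cong[OF that(3)] in \<open>simp add: r_def\<close>, metis)
  have "(\<lambda>\<gamma>. N #>\<^bsub>S\<^esub> \<gamma>) ` \<Gamma> \<subseteq> (\<lambda>p. N #>\<^bsub>S\<^esub> inv_into \<Gamma> r p) ` (r ` \<Gamma>)"
  proof (rule image_subsetI)
    fix \<gamma> assume g: "\<gamma> \<in> \<Gamma>"
    then have "N #>\<^bsub>S\<^esub> \<gamma> = N #>\<^bsub>S\<^esub> inv_into \<Gamma> r (r \<gamma>)"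
      by (intro eq) (auto simp: inv_into_into f_inv_into_f)
    then show "N #>\<^bsub>S\<^esub> \<gamma> \<in> (\<lambda>p. N #>\<^bsub>S\<^esub> inv_into \<Gamma> r p) ` (r ` \<Gamma>)" using g by blast
  qed
  then show ?thesis unfolding carrier_Mod_S using fin finite_surj by blast
qed

lemma level_kernel_fin_index: "level_kernel l \<in> fin_index_normals S"
  using normal_level_kernel finite_index_of_level_stab by (auto simp: fin_index_normals_def)

end

section \<open>Profinite completion and closure\<close>

text \<open>
  In such a group the level stabilizers are cofinal among the finite index normal subgroups, so
  that the completion can be computed along the levels of the tree, as the closure is.
\<close>
locale congruence_tree_group = tree_group +
  assumes congruence: "\<And>N. N \<in> fin_index_normals S \<Longrightarrow> \<exists>l. level_kernel l \<subseteq> N"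
begin

abbreviation F :: "('a list \<Rightarrow> 'a list) set set" where "F \<equiv> fin_index_normals S"

abbreviation C :: "(('a list \<Rightarrow> 'a list) set \<Rightarrow> ('a list \<Rightarrow> 'a list) set) set" where
  "C \<equiv> carrier (profinite_completion S)"

lemma normal_F: "N \<in> F \<Longrightarrow> N \<lhd> S"
  by (simp add: fin_index_normals_def)

lemma in_C_iff:
  "c \<in> C \<longleftrightarrow> c \<in> extensional F \<and> (\<forall>N\<in>F. \<exists>\<gamma>\<in>\<Gamma>. c N = N #>\<^bsub>S\<^esub> \<gamma>) \<and> (\<forall>M\<in>F. \<forall>N\<in>F. M \<subseteq> N \<longrightarrow> c M \<subseteq> c N)"
  unfolding profinite_completion_def by (auto simp: carrier_Mod_S PiE_def Pi_def image_iff)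

lemma C_carrier: "c \<in> C \<Longrightarrow> N \<in> F \<Longrightarrow> c N \<in> carrier (S Mod N)"
  unfolding in_C_iff carrier_Mod_S by blast

lemma C_mono: "c \<in> C \<Longrightarrow> M \<in> F \<Longrightarrow> N \<in> F \<Longrightarrow> M \<subseteq> N \<Longrightarrow> c M \<subseteq> c N"
  unfolding in_C_iff by blast

text \<open>
  The automorphism determined by a compatible family \<open>c\<close> of cosets: on level \<open>l\<close> all elements of
  \<open>c (level_kernel l)\<close> agree, and by compatibility they have the same effect on \<open>w\<close> as the
  elements of \<open>c (level_kernel m)\<close> for larger \<open>m\<close>.
\<close>
definition limit :: "(('a list \<Rightarrow> 'a list) set \<Rightarrow> ('a list \<Rightarrow> 'a list) set) \<Rightarrow> 'a list \<Rightarrow> 'a list" where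
  "limit c w = (SOME \<gamma>. \<gamma> \<in> c (level_kernel (length w))) w"

lemma C_coset:
  assumes c: "c \<in> C" and N: "N \<in> F" and g: "\<gamma> \<in> c N"
  shows "\<gamma> \<in> \<Gamma>" "c N = N #>\<^bsub>S\<^esub> \<gamma>"
proof -
  obtain \<delta> where \<delta>: "\<delta> \<in> \<Gamma>" "c N = N #>\<^bsub>S\<^esub> \<delta>" using c N by (auto simp: in_C_iff)
  show "\<gamma> \<in> \<Gamma>" "c N = N #>\<^bsub>S\<^esub> \<gamma>" using rcoset_eqI[OF normal_F[OF N] \<delta>(1)] g \<delta>(2) by auto
qed

lemma C_nonempty:
  assumes "c \<in> C" "N \<in> F"
  obtains \<gamma> where "\<gamma> \<in> c N"
  using assms rcoset_self[OF normal_F] unfolding in_C_iff by metis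

lemma level_kernel_mono: "l \<le> m \<Longrightarrow> level_kernel m \<subseteq> level_kernel l"
  unfolding level_kernel_def level_stab_def using tree_auts_agree_below[where \<beta> = id] by auto

lemma limit_eq:
  assumes c: "c \<in> C" and g: "\<gamma> \<in> c (level_kernel l)" and w: "length w \<le> l"
  shows "limit c w = \<gamma> w"
proof -
  let ?N = "level_kernel (length w)"
  have g': "\<gamma> \<in> c ?N" using C_mono[OF c level_kernel_fin_index level_kernel_fin_index level_kernel_mono[OF w]] g by blast
  define \<delta> where "\<delta> = (SOME \<delta>. \<delta> \<in> c ?N)"
  have d: "\<delta> \<in> c ?N" unfolding \<delta>_def by (rule someI[where P = "\<lambda>\<delta>. \<delta> \<in> c ?N", OF g'])
  have "\<gamma> \<in> ?N #>\<^bsub>S\<^esub> \<delta>" using C_coset(2)[OF c level_kernel_fin_index d] g' by simp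
  then obtain \<kappa> where "\<kappa> \<in> ?N" "\<gamma> = \<kappa> \<circ> \<delta>" unfolding rcoset_S by blast
  moreover have "length (\<delta> w) = length w"
    using C_coset(1)[OF c level_kernel_fin_index d] \<Gamma>_closed(1) length_tree_aut by blast
  moreover have "limit c w = \<delta> w" by (simp add: limit_def \<delta>_def)
  ultimately show ?thesis by (simp add: level_kernel_def level_stab_def)
qed

text \<open>
  Hence \<open>limit c\<close> determines \<open>c\<close>: if \<open>N\<close> contains a level stabilizer, then the value at \<open>N\<close>
  is the coset of any group element that approximates \<open>limit c\<close> on that level.
\<close>
lemma coset_of_agreeing:
  assumes c: "c \<in> C" and N: "N \<in> F" "level_kernel l \<subseteq> N" and g: "\<gamma> \<in> \<Gamma>" "\<And>w. length w = l \<Longrightarrow> \<gamma> w = limit c w"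
  shows "c N = N #>\<^bsub>S\<^esub> \<gamma>"
proof -
  obtain \<delta> where d: "\<delta> \<in> c (level_kernel l)" using C_nonempty[OF c level_kernel_fin_index] .
  have "\<delta> \<in> c N" using C_mono[OF c level_kernel_fin_index N] d by blast
  then have "c N = N #>\<^bsub>S\<^esub> \<delta>" "\<delta> \<in> \<Gamma>" using C_coset[OF c N(1)] by blast+
  moreover have "N #>\<^bsub>S\<^esub> \<gamma> = N #>\<^bsub>S\<^esub> \<delta>"
    by (rule agree_rcoset_eq[OF normal_F[OF N(1)] N(2) g(1) calculation(2)])
      (use g(2) limit_eq[OF c d] in simp)
  ultimately show ?thesis by simp
qed

lemma limit_in_closure:
  assumes c: "c \<in> C"
  shows "limit c \<in> tree_closure \<Gamma>"
proof -
  have ex: "\<exists>\<gamma>\<in>\<Gamma>. \<forall>w. length w \<le> l \<longrightarrow> limit c w = \<gamma> w" for l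
    using C_nonempty[OF c level_kernel_fin_index[of l]] limit_eq[OF c] C_coset(1)[OF c level_kernel_fin_index] by metis
  then have "limit c \<in> tree_auts" using \<Gamma>_closed(1) by (intro tree_auts_limit) blast
  moreover have "\<exists>\<gamma>\<in>\<Gamma>. \<gamma> \<in> level_ball (limit c) l" for l
  proof -
    obtain \<gamma> where "\<gamma> \<in> \<Gamma>" "\<forall>w. length w \<le> l \<longrightarrow> limit c w = \<gamma> w" using ex by blast
    then show ?thesis using \<Gamma>_closed(1)[of \<gamma>] by (intro bexI[of _ \<gamma>]) (auto simp: level_ball_def)
  qed
  ultimately show ?thesis by (simp add: in_tree_closure_iff)
qed

text \<open>
  The inverse of \<open>limit\<close>. For \<open>f\<close> in the closure all cosets in the union coincide
  (\<open>germ_eq\<close>); taking the union avoids choosing an approximation of \<open>f\<close>. The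
  restriction to finite index normal subgroups matches the extensional functions that
  form the completion.
\<close>
definition germ :: "('a list \<Rightarrow> 'a list) \<Rightarrow> ('a list \<Rightarrow> 'a list) set \<Rightarrow> ('a list \<Rightarrow> 'a list) set" where
  "germ f = (\<lambda>N\<in>F. \<Union>{N #>\<^bsub>S\<^esub> \<gamma> | \<gamma> l. level_kernel l \<subseteq> N \<and> \<gamma> \<in> \<Gamma> \<inter> level_ball f l})"

lemma germ_eq:
  assumes f: "f \<in> tree_closure \<Gamma>" and N: "N \<in> F" "level_kernel l \<subseteq> N" and g: "\<gamma> \<in> \<Gamma>" "\<gamma> \<in> level_ball f l"
  shows "germ f N = N #>\<^bsub>S\<^esub> \<gamma>"
proof -
  have ft: "f \<in> tree_auts" using f by (simp add: in_tree_closure_iff)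
  have "N #>\<^bsub>S\<^esub> \<delta> = N #>\<^bsub>S\<^esub> \<gamma>" if d: "level_kernel m \<subseteq> N" "\<delta> \<in> \<Gamma>" "\<delta> \<in> level_ball f m" for m \<delta>
  proof -
    obtain \<eta> where e: "\<eta> \<in> \<Gamma>" "\<eta> \<in> level_ball f (max l m)" using f by (auto simp: in_tree_closure_iff)
    have eta: "\<eta> w = f w" if "length w \<le> max l m" for w
      by (rule tree_auts_agree_below[OF _ ft _ that]) (use e in \<open>auto simp: level_ball_def\<close>)
    have "N #>\<^bsub>S\<^esub> \<eta> = N #>\<^bsub>S\<^esub> \<gamma>"
      by (rule agree_rcoset_eq[OF normal_F[OF N(1)] N(2) e(1) g(1)]) (use eta g in \<open>simp add: level_ball_def\<close>)
    moreover have "N #>\<^bsub>S\<^esub> \<eta> = N #>\<^bsub>S\<^esub> \<delta>"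
      by (rule agree_rcoset_eq[OF normal_F[OF N(1)] d(1) e(1) d(2)]) (use eta d in \<open>simp add: level_ball_def\<close>)
    ultimately show ?thesis by simp
  qed
  then have "{N #>\<^bsub>S\<^esub> \<gamma> | \<gamma> l. level_kernel l \<subseteq> N \<and> \<gamma> \<in> \<Gamma> \<inter> level_ball f l} = {N #>\<^bsub>S\<^esub> \<gamma>}"
    using N(2) g by blast
  then show ?thesis using N(1) by (simp add: germ_def)
qed

lemma germ_obtain:
  assumes f: "f \<in> tree_closure \<Gamma>" and N: "N \<in> F"
  obtains \<gamma> l where "level_kernel l \<subseteq> N" "\<gamma> \<in> \<Gamma>" "\<gamma> \<in> level_ball f l" "germ f N = N #>\<^bsub>S\<^esub> \<gamma>"
proof -
  obtain l where l: "level_kernel l \<subseteq> N" using congruence[OF N] by blast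
  obtain \<gamma> where g: "\<gamma> \<in> \<Gamma>" "\<gamma> \<in> level_ball f l" using f by (auto simp: in_tree_closure_iff)
  show ?thesis using that[OF l g germ_eq[OF f N l g]] .
qed

lemma germ_in_C:
  assumes f: "f \<in> tree_closure \<Gamma>"
  shows "germ f \<in> C"
proof -
  have "germ f M \<subseteq> germ f N" if MN: "M \<in> F" "N \<in> F" "M \<subseteq> N" for M N
  proof -
    obtain \<gamma> l where "level_kernel l \<subseteq> M" "\<gamma> \<in> \<Gamma>" "\<gamma> \<in> level_ball f l" "germ f M = M #>\<^bsub>S\<^esub> \<gamma>"
      using germ_obtain[OF f MN(1)] .
    moreover have "germ f N = N #>\<^bsub>S\<^esub> \<gamma>"
      by (rule germ_eq[OF f MN(2)]) (use calculation MN in auto)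
    ultimately show ?thesis using MN(3) by (auto simp: rcoset_S)
  qed
  moreover have "\<exists>\<gamma>\<in>\<Gamma>. germ f N = N #>\<^bsub>S\<^esub> \<gamma>" if "N \<in> F" for N
    using germ_obtain[OF f that] by blast
  moreover have "germ f \<in> extensional F" unfolding germ_def by (rule restrict_extensional)
  ultimately show ?thesis unfolding in_C_iff by blast
qed

lemma limit_germ:
  assumes f: "f \<in> tree_closure \<Gamma>"
  shows "limit (germ f) = f"
proof
  fix w :: "'a list"
  obtain \<gamma> where g: "\<gamma> \<in> \<Gamma>" "\<gamma> \<in> level_ball f (length w)" using f by (auto simp: in_tree_closure_iff)
  have "\<gamma> \<in> germ f (level_kernel (length w))"
    using germ_eq[OF f level_kernel_fin_index order_refl g] rcoset_self[OF normal_level_kernel] by simp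
  then have "limit (germ f) w = \<gamma> w" by (rule limit_eq[OF germ_in_C[OF f]]) simp
  then show "limit (germ f) w = f w" using g by (simp add: level_ball_def)
qed

lemma germ_limit:
  assumes c: "c \<in> C"
  shows "germ (limit c) = c"
proof (rule extensionalityI)
  note f = limit_in_closure[OF c]
  show "germ (limit c) \<in> extensional F" "c \<in> extensional F" using c germ_in_C[OF f] by (auto simp: in_C_iff)
  fix N assume N: "N \<in> F"
  obtain \<gamma> l where g: "level_kernel l \<subseteq> N" "\<gamma> \<in> \<Gamma>" "\<gamma> \<in> level_ball (limit c) l" "germ (limit c) N = N #>\<^bsub>S\<^esub> \<gamma>"
    using germ_obtain[OF f N] .
  have "c N = N #>\<^bsub>S\<^esub> \<gamma>"
    by (rule coset_of_agreeing[OF c N g(1,2)]) (use g(3) in \<open>simp add: level_ball_def\<close>)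
  then show "germ (limit c) N = c N" using g(4) by simp
qed

lemma to_completion_in_C:
  assumes "\<gamma> \<in> \<Gamma>"
  shows "to_completion S \<gamma> \<in> C"
proof -
  have "M #>\<^bsub>S\<^esub> \<gamma> \<subseteq> N #>\<^bsub>S\<^esub> \<gamma>" if "M \<subseteq> N" for M N
    using that unfolding rcoset_S by blast
  then show ?thesis using assms unfolding in_C_iff to_completion_def by (simp, blast)
qed

lemma limit_to_completion:
  assumes "\<gamma> \<in> \<Gamma>"
  shows "limit (to_completion S \<gamma>) = \<gamma>"
proof
  fix w :: "'a list"
  have "\<gamma> \<in> to_completion S \<gamma> (level_kernel (length w))"
    using level_kernel_fin_index rcoset_self[OF normal_level_kernel] by (simp add: to_completion_def)
  then show "limit (to_completion S \<gamma>) w = \<gamma> w" by (rule limit_eq[OF to_completion_in_C[OF assms]]) simp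
qed

lemma mult_completion:
  "c \<otimes>\<^bsub>profinite_completion S\<^esub> d = (\<lambda>N\<in>F. c N <#>\<^bsub>S\<^esub> d N)"
  by (simp add: profinite_completion_def FactGroup_def)

lemma mult_in_C:
  assumes c: "c \<in> C" and d: "d \<in> C"
  shows "c \<otimes>\<^bsub>profinite_completion S\<^esub> d \<in> C"
proof -
  have "\<exists>\<gamma>\<in>\<Gamma>. c N <#>\<^bsub>S\<^esub> d N = N #>\<^bsub>S\<^esub> \<gamma>" if N: "N \<in> F" for N
  proof -
    obtain \<gamma> \<delta> where g: "\<gamma> \<in> \<Gamma>" "\<delta> \<in> \<Gamma>" "c N = N #>\<^bsub>S\<^esub> \<gamma>" "d N = N #>\<^bsub>S\<^esub> \<delta>"
      using c d N unfolding in_C_iff by meson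
    then have "c N <#>\<^bsub>S\<^esub> d N = N #>\<^bsub>S\<^esub> (\<gamma> \<circ> \<delta>)"
      using normal.rcos_sum[OF normal_F[OF N], of \<gamma> \<delta>] by simp
    then show ?thesis using g(1,2) \<Gamma>_closed(3) by blast
  qed
  moreover have "c M <#>\<^bsub>S\<^esub> d M \<subseteq> c N <#>\<^bsub>S\<^esub> d N" if "M \<in> F" "N \<in> F" "M \<subseteq> N" for M N
  proof -
    have "c M \<subseteq> c N" "d M \<subseteq> d N" using C_mono[OF c that] C_mono[OF d that] .
    then show ?thesis unfolding set_mult_def by blast
  qed
  ultimately show ?thesis unfolding mult_completion in_C_iff by simp
qed

lemma limit_mult:
  assumes c: "c \<in> C" and d: "d \<in> C"
  shows "limit (c \<otimes>\<^bsub>profinite_completion S\<^esub> d) = limit c \<circ> limit d"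
proof
  fix w :: "'a list"
  let ?level_kernel = "level_kernel (length w)"
  obtain \<gamma> \<delta> where g: "\<gamma> \<in> c ?level_kernel" "\<delta> \<in> d ?level_kernel" using C_nonempty c d level_kernel_fin_index by metis
  have "\<gamma> \<circ> \<delta> \<in> (c \<otimes>\<^bsub>profinite_completion S\<^esub> d) ?level_kernel"
    using g level_kernel_fin_index by (auto simp: mult_completion set_mult_def)
  then have "limit (c \<otimes>\<^bsub>profinite_completion S\<^esub> d) w = (\<gamma> \<circ> \<delta>) w"
    by (rule limit_eq[OF mult_in_C[OF c d]]) simp
  also have "length (\<delta> w) = length w"
    using C_coset(1)[OF d level_kernel_fin_index g(2)] \<Gamma>_closed(1) length_tree_aut by blast
  then have "(\<gamma> \<circ> \<delta>) w = (limit c \<circ> limit d) w"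
    using limit_eq[OF c g(1)] limit_eq[OF d g(2)] by simp
  finally show "limit (c \<otimes>\<^bsub>profinite_completion S\<^esub> d) w = (limit c \<circ> limit d) w" .
qed

lemma limit_iso: "limit \<in> iso (profinite_completion S) (aut_tree\<lparr>carrier := tree_closure \<Gamma>\<rparr>)"
proof -
  have "bij_betw limit C (tree_closure \<Gamma>)"
    by (rule bij_betw_byWitness[where f' = germ])
      (auto simp: germ_limit limit_germ limit_in_closure germ_in_C)
  then show ?thesis by (auto simp: iso_def hom_def limit_mult limit_in_closure)
qed

lemma topspace_profinite: "topspace (profinite_topology S) = C"
  by (auto simp: profinite_topology_def profinite_completion_def)

lemma topspace_closure: "topspace (subtopology aut_topology (tree_closure \<Gamma>)) = tree_closure \<Gamma>"
  by (auto simp: in_tree_closure_iff)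

text \<open>
  The automorphism \<open>limit c\<close> is known on level \<open>l\<close> as soon as the single coordinate
  \<open>c (level_kernel l)\<close> is.
\<close>
lemma limit_continuous:
  "continuous_map (profinite_topology S) (subtopology aut_topology (tree_closure \<Gamma>)) limit"
  unfolding continuous_map_in_subtopology
  unfolding continuous_map topspace_profinite
proof (intro conjI allI impI)
  show "limit \<in> C \<rightarrow> tree_closure \<Gamma>" using limit_in_closure by blast
  then show "limit ` C \<subseteq> topspace aut_topology" by (auto simp: in_tree_closure_iff)
  fix U :: "('a list \<Rightarrow> 'a list) set" assume U: "openin aut_topology U"
  show "openin (profinite_topology S) {c \<in> C. limit c \<in> U}"
  proof (subst openin_subopen, safe)
    fix c assume c: "c \<in> C" "limit c \<in> U"
    then obtain l where l: "level_ball (limit c) l \<subseteq> U" using U by (auto simp: openin_aut_topology_ball)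
    define T where "T = {d \<in> C. d (level_kernel l) = c (level_kernel l)}"
    have "continuous_map (profinite_topology S) (discrete_topology (carrier (S Mod level_kernel l))) (\<lambda>d. d (level_kernel l))"
      unfolding profinite_topology_def
      by (intro continuous_map_from_subtopology continuous_map_product_projection level_kernel_fin_index)
    moreover have "openin (discrete_topology (carrier (S Mod level_kernel l))) {c (level_kernel l)}"
      using C_carrier[OF c(1) level_kernel_fin_index] by simp
    ultimately have "openin (profinite_topology S) {d \<in> topspace (profinite_topology S). d (level_kernel l) \<in> {c (level_kernel l)}}"
      by (rule openin_continuous_map_preimage)
    then have "openin (profinite_topology S) T" by (simp add: T_def topspace_profinite)
    moreover have "limit d \<in> U" if d: "d \<in> T" for d
    proof -
      have dC: "d \<in> C" and e: "d (level_kernel l) = c (level_kernel l)" using d by (auto simp: T_def)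
      obtain \<gamma> where g: "\<gamma> \<in> c (level_kernel l)" using C_nonempty[OF c(1) level_kernel_fin_index] .
      have "limit d w = limit c w" if "length w = l" for w
        using limit_eq[OF c(1) g] limit_eq[OF dC, of \<gamma> l] that by (simp add: e g)
      then have "limit d \<in> level_ball (limit c) l"
        using limit_in_closure[OF dC] by (simp add: level_ball_def in_tree_closure_iff)
      then show ?thesis using l by blast
    qed
    ultimately show "\<exists>T. openin (profinite_topology S) T \<and> c \<in> T \<and> T \<subseteq> {c \<in> C. limit c \<in> U}"
      using c by (intro exI[of _ T]) (auto simp: T_def)
  qed
qed

text \<open>
  Each coordinate \<open>germ f N\<close> is locally constant in \<open>f\<close>: it depends only on the action of
  \<open>f\<close> on a level whose stabilizer is contained in \<open>N\<close>.
\<close>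
lemma germ_continuous:
  "continuous_map (subtopology aut_topology (tree_closure \<Gamma>)) (profinite_topology S) germ"
  unfolding profinite_topology_def continuous_map_in_subtopology continuous_map_componentwise topspace_closure
proof (intro conjI ballI)
  show "germ \<in> tree_closure \<Gamma> \<rightarrow> C" using germ_in_C by blast
  show "germ ` tree_closure \<Gamma> \<subseteq> extensional F"
    unfolding germ_def by (rule image_subsetI) (rule restrict_extensional)
  fix N assume N: "N \<in> F"
  show "continuous_map (subtopology aut_topology (tree_closure \<Gamma>)) (discrete_topology (carrier (S Mod N)))
      (\<lambda>f. germ f N)"
    unfolding continuous_map topspace_closure
  proof (intro conjI allI impI)
    show "(\<lambda>f. germ f N) ` tree_closure \<Gamma> \<subseteq> topspace (discrete_topology (carrier (S Mod N)))"
      using C_carrier[OF germ_in_C N] by auto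
    fix U
    show "openin (subtopology aut_topology (tree_closure \<Gamma>)) {f \<in> tree_closure \<Gamma>. germ f N \<in> U}"
    proof (subst openin_subopen, safe)
      fix f assume f: "f \<in> tree_closure \<Gamma>" "germ f N \<in> U"
      obtain \<gamma> l where g: "level_kernel l \<subseteq> N" "\<gamma> \<in> \<Gamma>" "\<gamma> \<in> level_ball f l" "germ f N = N #>\<^bsub>S\<^esub> \<gamma>"
        using germ_obtain[OF f(1) N] .
      define T where "T = tree_closure \<Gamma> \<inter> level_ball f l"
      have "openin (subtopology aut_topology (tree_closure \<Gamma>)) T"
        unfolding T_def by (rule openin_subtopology_Int2[OF openin_level_ball])
      moreover have "f \<in> T" using f(1) by (simp add: T_def level_ball_def in_tree_closure_iff)
      moreover have "germ h N = germ f N" if h: "h \<in> T" for h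
      proof -
        have "h \<in> tree_closure \<Gamma>" "\<gamma> \<in> level_ball h l"
          using g(3) h by (simp_all add: T_def level_ball_def)
        then show ?thesis unfolding g(4) by (intro germ_eq[OF _ N g(1,2)])
      qed
      then have "T \<subseteq> {f \<in> tree_closure \<Gamma>. germ f N \<in> U}" using f(2) by (auto simp: T_def)
      ultimately show "\<exists>T. openin (subtopology aut_topology (tree_closure \<Gamma>)) T \<and> f \<in> T \<and>
          T \<subseteq> {f \<in> tree_closure \<Gamma>. germ f N \<in> U}" by blast
    qed
  qed
qed

lemma congruence_subgroup_property: "congruence_subgroup_property \<Gamma>"
proof -
  have "homeomorphic_maps (profinite_topology S) (subtopology aut_topology (tree_closure \<Gamma>)) limit germ"
    unfolding homeomorphic_maps_def topspace_closure topspace_profinite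
    using limit_continuous germ_continuous limit_germ germ_limit by blast
  then have "homeomorphic_map (profinite_topology S) (subtopology aut_topology (tree_closure \<Gamma>)) limit"
    unfolding homeomorphic_map_maps by blast
  then show ?thesis
    unfolding congruence_subgroup_property_def Let_def using limit_to_completion limit_iso by blast
qed

end

context tree_group
begin

text \<open>
  In an infinite group the trivial subgroup has infinite index, so the hypothesis on non-trivial
  normal subgroups covers all normal subgroups of finite index.
\<close>
lemma just_infinite_and_csp:
  assumes inf: "infinite \<Gamma>" and N: "\<And>N. \<lbrakk>N \<lhd> S; N \<noteq> {id}\<rbrakk> \<Longrightarrow> \<exists>l. level_kernel l \<subseteq> N"
  shows "just_infinite S" "congruence_subgroup_property \<Gamma>"
proof -
  have "finite (carrier (S Mod M))" if "M \<lhd> S" "M \<noteq> {id}" for M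
    using N[OF that] finite_index_of_level_stab[OF that(1)] by blast
  then show "just_infinite S" unfolding just_infinite_def using group_S inf by simp
  have "congruence_tree_group \<Gamma>"
  proof (unfold_locales)
    fix N assume "N \<in> fin_index_normals S"
    then have n: "N \<lhd> S" "finite (carrier (S Mod N))" by (auto simp: fin_index_normals_def)
    have "N \<noteq> {id}"
    proof
      assume e: "N = {id}"
      have "inj_on (\<lambda>\<gamma>. N #>\<^bsub>S\<^esub> \<gamma>) \<Gamma>" unfolding rcoset_S e by (auto intro: inj_onI)
      then show False using n(2) inf unfolding carrier_Mod_S by (simp add: finite_image_iff)
    qed
    then show "\<exists>l. level_kernel l \<subseteq> N" using N n by blast
  qed
  then show "congruence_subgroup_property \<Gamma>" by (rule congruence_tree_group.congruence_subgroup_property)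
qed

end

section \<open>Just infiniteness and the congruence subgroup property\<close>

context perfect_H_group
begin

text \<open>
  A transitive action on level \<open>n\<close> forces at least \<open>2\<^sup>n\<close> elements, for every \<open>n\<close>.
\<close>
lemma infinite_Gam:
  assumes \<Omega>: "spines \<Omega>"
  shows "infinite (Gam b G \<Omega>)"
proof
  assume fin: "finite (Gam b G \<Omega>)"
  define n where "n = card (Gam b G \<Omega>)"
  obtain \<omega> where "\<omega> \<in> \<Omega>" "\<omega> 0 \<noteq> b" using \<Omega> by (auto simp: spines_def spine_seqs_def)
  then have "card {b, \<omega> 0} = 2" by simp
  then have q: "card (UNIV :: 'x set) \<ge> 2" by (metis card_mono finite subset_UNIV)
  have "{v :: 'x list. length v = n} \<subseteq> (\<lambda>\<gamma>. \<gamma> (replicate n b)) ` Gam b G \<Omega>"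
  proof
    fix v :: "'x list" assume "v \<in> {v. length v = n}"
    then obtain \<gamma> where "\<gamma> \<in> Gam b G \<Omega>" "\<gamma> (replicate n b) = v"
      using level_transitive_Gam[OF \<Omega>, of "replicate n b" v] by auto
    then show "v \<in> (\<lambda>\<gamma>. \<gamma> (replicate n b)) ` Gam b G \<Omega>" by blast
  qed
  then have "card {v :: 'x list. length v = n} \<le> n"
    unfolding n_def using surj_card_le[OF fin] by blast
  moreover have "card {v :: 'x list. length v = n} = card (UNIV :: 'x set) ^ n"
    using card_lists_length_eq[of "UNIV :: 'x set" n] by simp
  moreover have "n < 2 ^ n" by (rule less_exp)
  moreover have "2 ^ n \<le> card (UNIV :: 'x set) ^ n" using q by (rule power_mono) simp
  ultimately show False by linarith
qed

end

theorem theorem4p5: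
  fixes b :: "'x::finite" and G :: "('x list \<Rightarrow> 'x list) set"
  assumes "subgroup G aut_tree"
    and "perfect_group (aut_tree\<lparr>carrier := G\<rparr>)"
    and "self_similar G"
    and "property_H G"
  shows "\<forall>\<Omega>. \<Omega> \<noteq> {} \<and> \<Omega> \<subseteq> spine_seqs b \<longrightarrow>
           just_infinite (aut_tree\<lparr>carrier := Gam b G \<Omega>\<rparr>) \<and>
           congruence_subgroup_property (Gam b G \<Omega>)"
proof (intro allI impI)
  fix \<Omega> assume "\<Omega> \<noteq> {} \<and> \<Omega> \<subseteq> spine_seqs b"
  have "derived aut_tree G = G"
    using assms(2) group.derived_consistent[OF group_aut_tree order_refl assms(1)]
    by (simp add: perfect_group_def)
  then interpret perfect_H_group b G
    using assms by (simp add: perfect_H_group_def)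
  have \<Omega>: "spines \<Omega>" using \<open>\<Omega> \<noteq> {} \<and> \<Omega> \<subseteq> spine_seqs b\<close> by (simp add: spines_def)
  interpret \<Gamma>: tree_group "Gam b G \<Omega>" by (rule tree_group.intro[OF subgroup_Gam])
  have "\<exists>l. \<Gamma>.level_kernel l \<subseteq> N" if "N \<lhd> \<Gamma>.S" "N \<noteq> {id}" for N
  proof -
    have n: "subgroup N aut_tree" "N \<subseteq> Gam b G \<Omega>"
      "\<forall>\<gamma>\<in>Gam b G \<Omega>. \<forall>\<nu>\<in>N. \<gamma> \<circ> \<nu> \<circ> aut_inv \<gamma> \<in> N"
      using that(1) unfolding \<Gamma>.normal_S_iff by auto
    show ?thesis unfolding \<Gamma>.level_kernel_def
      by (rule normal_contains_level_stab[OF \<Omega> n(1,2) that(2)]) (use n(3) in blast)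
  qed
  then show "just_infinite (aut_tree\<lparr>carrier := Gam b G \<Omega>\<rparr>) \<and> congruence_subgroup_property (Gam b G \<Omega>)"
    by (intro conjI \<Gamma>.just_infinite_and_csp infinite_Gam[OF \<Omega>])
qed

end
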